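(* Let $K \subset \mathbb{R}^{2}$ be a compact set, and suppose that there is a set of directions $E_{0} \subset S^{1}$ (not assumed to be measurable) with $\mathcal{H}^{1}(E_{0}) > 0$ such that for every $e \in E_{0}$ the set $K$ contains the union of some positive-dimensional family of line segments perpendicular to $e$; that is, for every $e \in E_{0}$ there exist $s_{e} \in (0,1]$ and a family $\mathcal{L}_{e}$ of line segments perpendicular to $e$ such that $\bigcup \mathcal{L}_{e} \subset K$ and $\mathcal{H}^{s_{e}}(\rho_{e}(\bigcup \mathcal{L}_{e})) > 0$. Then $\mathcal{L}^{2}(K) > 0$.
   Context: $S^{1}$ is the unit circle in $\mathbb{R}^{2}$, $\mathcal{L}^{2}$ is Lebesgue measure on $\mathbb{R}^{2}$, and $\mathcal{H}^{s}$ is the $s$-dimensional Hausdorff (outer) measure. For $e \in S^{1}$, $\rho_{e} \colon \mathbb{R}^{2} \to \mathbb{R}$ is the orthogonal projection $\rho_{e}(x) = x \cdot e$. Line segments are non-degenerate (of positive length). Given $e \in S^{1}$ and $s \in [0,1]$, a family $\mathcal{L}$ of line segments perpendicular to $e$ is called $s$-dimensional if its union $L = \bigcup \mathcal{L} \subset \mathbb{R}^{2}$ satisfies $\mathcal{H}^{s}(\rho_{e}(L)) > 0$; it is called positive-dimensional if it is $s$-dimensional for some $s > 0$. No measurability is imposed on $L$ or $\rho_{e}(L)$. *)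

theory Defs
  imports "HOL-Analysis.Analysis"
begin

text \<open>Hausdorff outer measure with the normalisation in which a cover is charged the sum of
  \<open>diam\<^sup>s\<close>; in particular it is defined for arbitrary, possibly non-measurable, sets.\<close>

text \<open>The case \<open>s = 0\<close> is separate because \<open>0 powr 0 = 0\<close>, whereas the convention
  needed for counting measure is \<open>diam\<^sup>0 = 1\<close> for every nonempty set.\<close>

definition hausdorff_gauge :: "real \<Rightarrow> 'a::metric_space set \<Rightarrow> ennreal" where
  "hausdorff_gauge s U =
     (if U = {} then 0 else if s = 0 then 1 else ennreal (diameter U powr s))"

text \<open>Boundedness is required explicitly since \<open>diameter\<close> carries no information on
  unbounded sets. Finite covers are included by padding with empty sets.\<close>

definition hausdorff_premeasure :: "real \<Rightarrow> real \<Rightarrow> 'a::metric_space set \<Rightarrow> ennreal" where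
  "hausdorff_premeasure s \<delta> A =
     (INF U \<in> {U :: nat \<Rightarrow> 'a set. A \<subseteq> (\<Union>i. U i) \<and> (\<forall>i. bounded (U i) \<and> diameter (U i) \<le> \<delta>)}.
        \<Sum>i. hausdorff_gauge s (U i))"

definition hausdorff_measure :: "real \<Rightarrow> 'a::metric_space set \<Rightarrow> ennreal" where
  "hausdorff_measure s A = (SUP \<delta> \<in> {0<..}. hausdorff_premeasure s \<delta> A)"

definition proj_dir :: "real^2 \<Rightarrow> real^2 \<Rightarrow> real" where
  "proj_dir e x = x \<bullet> e"

definition line_segment_perp :: "real^2 \<Rightarrow> (real^2) set \<Rightarrow> bool" where
  "line_segment_perp e S \<longleftrightarrow>
     (\<exists>a b. a \<noteq> b \<and> S = closed_segment a b \<and> (b - a) \<bullet> e = 0)"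

definition dimensional_family :: "real \<Rightarrow> real^2 \<Rightarrow> (real^2) set set \<Rightarrow> bool" where
  "dimensional_family s e F \<longleftrightarrow>
     (\<forall>S\<in>F. line_segment_perp e S) \<and> hausdorff_measure s (proj_dir e ` (\<Union>F)) > 0"

definition positive_dimensional_family :: "real^2 \<Rightarrow> (real^2) set set \<Rightarrow> bool" where
  "positive_dimensional_family e F \<longleftrightarrow> (\<exists>s\<in>{0<..1}. dimensional_family s e F)"

end

theory Submission
  imports Defs
begin

text \<open>The proof is an \<open>L\<^sup>2\<close> argument. Write the lines as \<open>y = m x + c\<close>. At a small scale \<open>d\<close>, choose one
slope from each interval of length \<open>d\<close> that meets the set of slopes; there are about \<open>1 / d\<close> of them. For each
slope put weights on finitely many intercepts of segments in \<open>K\<close> such that an interval of length \<open>r\<close>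
has weight at most about \<open>r powr s\<close>. Let \<open>f\<close> be the weighted sum of the indicators of
the strips of width \<open>d\<close> around the resulting segments. Two strips whose slopes differ by \<open>r\<close> overlap in area at
most about \<open>d\<^sup>2 / r\<close>. If the families were single segments, summing this over all slopes would produce the factor
\<open>log (1 / d)\<close> that lets Kakeya sets have measure zero. Here, however, strips of slope \<open>m'\<close> with
\<open>\<bar>m - m'\<bar> = r\<close> meet a given strip of slope \<open>m\<close> only if their intercepts lie in an interval of length
about \<open>r\<close>, and these have weight about \<open>r powr s\<close>. The gain \<open>r powr s\<close> turns the
divergent \<open>\<integral> dr / r\<close> into a convergent integral, so \<open>\<integral> f\<^sup>2\<close> is at most a constant times
\<open>(\<integral> f)\<^sup>2\<close>, uniformly in \<open>d\<close>. By Cauchy-Schwarz the union of the strips has measure bounded below.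
Since it lies in an arbitrarily small neighbourhood of the compact set \<open>K\<close>, so has \<open>K\<close>.

The analytic core is \<open>strip_family_measure_lower_bound\<close>, fed by the weights of \<open>discrete_frostman\<close>, and the
passage to \<open>K\<close> is \<open>emeasure_pos_if_uniform_segments\<close>. The sets of directions and of intercepts are arbitrary, which
is harmless for two reasons: the weights are increments of Hausdorff content, which is subadditive on all sets, and
uniform constants come from \<open>hausdorff_measure_UN_pos\<close>, the countable subadditivity of the outer measure.\<close>

section \<open>Hausdorff content and measure\<close>

lemma hausdorff_gauge_eq_powr:
  "0 < s \<Longrightarrow> hausdorff_gauge s U = ennreal (diameter U powr s)"
  by (auto simp: hausdorff_gauge_def)

lemma hausdorff_premeasure_le_cover:
  assumes "A \<subseteq> (\<Union>i. U i)" "\<And>i. bounded (U i)" "\<And>i. diameter (U i) \<le> d"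
  shows "hausdorff_premeasure s d A \<le> (\<Sum>i. hausdorff_gauge s (U i))"
  unfolding hausdorff_premeasure_def by (rule INF_lower) (use assms in auto)

lemma hausdorff_premeasure_less_cover:
  assumes "hausdorff_premeasure s d A < x"
  obtains U :: "nat \<Rightarrow> 'a::metric_space set" where "A \<subseteq> (\<Union>i. U i)" "\<And>i. bounded (U i)"
    "\<And>i. diameter (U i) \<le> d" "(\<Sum>i. hausdorff_gauge s (U i)) < x"
  using assms unfolding hausdorff_premeasure_def INF_less_iff by blast

lemma hausdorff_premeasure_mono:
  assumes "A \<subseteq> B"
  shows "hausdorff_premeasure s d A \<le> hausdorff_premeasure s d B"
  unfolding hausdorff_premeasure_def by (rule INF_superset_mono) (use assms in auto)

lemma hausdorff_measure_mono:
  assumes "A \<subseteq> B"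
  shows "hausdorff_measure s A \<le> hausdorff_measure s B"
  unfolding hausdorff_measure_def by (intro SUP_mono' hausdorff_premeasure_mono assms)

text \<open>The usual outer-measure argument: almost optimal covers of the sets \<open>A n\<close>, the \<open>n\<close>-th one with an
excess of \<open>\<epsilon> / 2\<^sup>n\<^sup>+\<^sup>1\<close>, are enumerated as a single sequence.\<close>

lemma hausdorff_premeasure_countable_subadditive:
  fixes A :: "nat \<Rightarrow> 'a::metric_space set"
  shows "hausdorff_premeasure s d (\<Union>n. A n) \<le> (\<Sum>n. hausdorff_premeasure s d (A n))"
proof (rule ennreal_le_epsilon)
  fix e :: real
  assume fin: "(\<Sum>n. hausdorff_premeasure s d (A n)) < top" and "0 < e"
  let ?P = "\<lambda>n. hausdorff_premeasure s d (A n)"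
  let ?e = "\<lambda>n::nat. ennreal e * ennreal ((1/2) ^ Suc n)"
  have "?P n < ?P n + ?e n" for n
  proof -
    have "?P n < top"
      by (rule ennreal_suminf_lessD[OF fin])
    moreover have "0 < ?e n" using \<open>0 < e\<close>
      by (simp add: ennreal_zero_less_mult_iff)
    ultimately show ?thesis
      by (metis add.right_neutral ennreal_add_left_cancel_less infinity_ennreal_def less_irrefl)
  qed
  then have "\<exists>U. A n \<subseteq> (\<Union>i. U i) \<and> (\<forall>i. bounded (U i) \<and> diameter (U i) \<le> d) \<and>
      (\<Sum>i. hausdorff_gauge s (U i)) < ?P n + ?e n" for n
    by (metis hausdorff_premeasure_less_cover)
  then obtain U where U: "\<And>n. A n \<subseteq> (\<Union>i. U n i)" "\<And>n i. bounded (U n i)"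
    "\<And>n i. diameter (U n i) \<le> d" "\<And>n. (\<Sum>i. hausdorff_gauge s (U n i)) < ?P n + ?e n"
    by metis
  define V where "V = (\<lambda>k. case_prod U (prod_decode k))"
  have "(\<Union>n. A n) \<subseteq> (\<Union>k. V k)"
  proof
    fix x assume "x \<in> (\<Union>n. A n)"
    then obtain n i where "x \<in> U n i" using U(1) by blast
    then have "x \<in> V (prod_encode (n, i))" by (simp add: V_def)
    then show "x \<in> (\<Union>k. V k)" by blast
  qed
  then have "hausdorff_premeasure s d (\<Union>n. A n) \<le> (\<Sum>k. hausdorff_gauge s (V k))"
    by (rule hausdorff_premeasure_le_cover) (auto simp: V_def U split: prod.splits)
  also have "\<dots> = (\<Sum>k. (\<lambda>p. hausdorff_gauge s (case_prod U p)) (prod_decode k))"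
    by (simp add: V_def)
  also have "\<dots> = (\<Sum>n. \<Sum>i. hausdorff_gauge s (U n i))"
    by (rule suminf_ennreal_2dimen) simp
  also have "\<dots> \<le> (\<Sum>n. ?P n + ?e n)"
    by (intro suminf_le less_imp_le U) auto
  also have "\<dots> = (\<Sum>n. ?P n) + (\<Sum>n. ?e n)"
    by (subst suminf_add[symmetric]) auto
  also have "(\<Sum>n. ?e n) = ennreal e"
    unfolding ennreal_suminf_cmult
    by (subst suminf_ennreal_eq[OF zero_le_power power_half_series]) auto
  finally show "hausdorff_premeasure s d (\<Union>n. A n) \<le> (\<Sum>n. ?P n) + ennreal e" .
qed

lemma hausdorff_premeasure_empty: "0 \<le> d \<Longrightarrow> hausdorff_premeasure s d {} = 0"
  using hausdorff_premeasure_le_cover[of "{}" "\<lambda>_. {}" d s]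
  by (simp add: hausdorff_gauge_def)

lemma hausdorff_premeasure_Un:
  assumes "0 \<le> d"
  shows "hausdorff_premeasure s d (A \<union> B) \<le> hausdorff_premeasure s d A + hausdorff_premeasure s d B"
proof -
  have "A \<union> B = (\<Union>n. binaryset A B n)"
    by (simp add: UN_binaryset_eq)
  then show ?thesis
    using hausdorff_premeasure_countable_subadditive[of s d "binaryset A B"]
      suminf_binaryset_eq[of "hausdorff_premeasure s d" A B] assms
    by (simp add: hausdorff_premeasure_empty)
qed

lemma hausdorff_premeasure_finite_UN:
  assumes "finite I" "0 \<le> d"
  shows "hausdorff_premeasure s d (\<Union>i\<in>I. A i) \<le> (\<Sum>i\<in>I. hausdorff_premeasure s d (A i))"
  using assms(1)
proof induction
  case (insert i I)
  then show ?case
    using hausdorff_premeasure_Un[OF assms(2), of s "A i" "\<Union>i\<in>I. A i"]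
    by simp (meson add_left_mono order_trans)
qed (simp add: assms hausdorff_premeasure_empty)

lemma hausdorff_premeasure_le_gauge:
  assumes "0 < s" "bounded A" "diameter A \<le> d"
  shows "hausdorff_premeasure s d A \<le> ennreal (diameter A powr s)"
proof -
  have "0 \<le> d" using assms diameter_ge_0 order_trans by blast
  have eq: "(\<Sum>i. hausdorff_gauge s (binaryset A {} i)) = ennreal (diameter A powr s)"
    by (subst suminf_binaryset_eq) (auto simp: hausdorff_gauge_eq_powr assms(1))
  show ?thesis
    unfolding eq[symmetric]
    by (rule hausdorff_premeasure_le_cover)
      (use assms \<open>0 \<le> d\<close> in \<open>auto simp: UN_binaryset_eq binaryset_def\<close>)
qed

text \<open>Single intervals as covers: this is what makes the distribution function of the content
Hoelder continuous.\<close>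

lemma hausdorff_premeasure_interval:
  fixes A :: "real set"
  assumes "0 < s" "A \<subseteq> {a..b}" "a \<le> b" "b - a \<le> d"
  shows "hausdorff_premeasure s d A \<le> ennreal ((b - a) powr s)"
proof -
  have le: "diameter {a..b} = b - a"
    using assms(3) by (simp add: diameter_closed_interval)
  have "hausdorff_premeasure s d A \<le> hausdorff_premeasure s d {a..b}"
    by (rule hausdorff_premeasure_mono) fact
  also have "\<dots> \<le> ennreal ((b - a) powr s)"
    using hausdorff_premeasure_le_gauge[of s "{a..b}" d] assms by (simp add: le)
  finally show ?thesis .
qed

lemma hausdorff_measure_eq_0_iff:
  "hausdorff_measure s A = 0 \<longleftrightarrow> (\<forall>d>0. hausdorff_premeasure s d A = 0)"
  unfolding hausdorff_measure_def by (auto simp: SUP_eq_iff bot_ennreal[symmetric] simp del: bot_ennreal)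

text \<open>Null sets are closed under countable unions, so a set of positive measure cannot be cut into countably
many null pieces. Every choice of uniform constants below is an application of this
pigeonhole principle.\<close>

lemma hausdorff_measure_UN_pos:
  fixes A :: "'i \<Rightarrow> 'a::metric_space set"
  assumes "0 < hausdorff_measure s (\<Union>i\<in>I. A i)" "countable I"
  obtains i where "i \<in> I" "0 < hausdorff_measure s (A i)"
proof (rule ccontr)
  assume "\<not> thesis"
  with that have z: "\<And>i. i \<in> I \<Longrightarrow> hausdorff_measure s (A i) = 0"
    by (metis not_gr_zero)
  show False
  proof (cases "I = {}")
    case True
    then show ?thesis
      using assms(1) hausdorff_measure_eq_0_iff[of s "{}::'a set"]
      by (simp add: hausdorff_premeasure_empty)
  next
    case False
    have "hausdorff_premeasure s d (\<Union>i\<in>I. A i) = 0" if "0 < d" for d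
    proof -
      have "(\<Union>i\<in>I. A i) = (\<Union>n. A (from_nat_into I n))"
        using range_from_nat_into[OF False assms(2)] by (metis image_image)
      moreover have "hausdorff_premeasure s d (A (from_nat_into I n)) = 0" for n
        using z from_nat_into[OF False] that hausdorff_measure_eq_0_iff by blast
      ultimately show ?thesis
        using hausdorff_premeasure_countable_subadditive[of s d "\<lambda>n. A (from_nat_into I n)"]
        by simp
    qed
    then show False
      using assms(1) hausdorff_measure_eq_0_iff[of s "\<Union>i\<in>I. A i"] by simp
  qed
qed

text \<open>The scale \<open>D\<close> is arbitrary, possibly large: a cover with a tiny sum of \<open>diam\<^sup>t\<close> automatically consists of
sets of tiny diameter, so that it is admissible at every prescribed scale; and as these diameters are
below \<open>1\<close>, raising the exponent from \<open>t\<close> to \<open>s\<close> only decreases the sum. Large \<open>D\<close> removes the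
restriction to short intervals in the mass bounds below.\<close>

lemma hausdorff_premeasure_pos:
  assumes "0 < hausdorff_measure s A" "0 < t" "t \<le> s"
  shows "0 < hausdorff_premeasure t D A"
proof (rule ccontr)
  assume "\<not> ?thesis"
  then have 0: "hausdorff_premeasure t D A = 0" by (simp add: not_gr_zero)
  have "hausdorff_premeasure s d A = 0" if "0 < d" for d
  proof -
    have "hausdorff_premeasure s d A \<le> 0 + ennreal e" if "0 < e" for e
    proof -
      \<comment> \<open>The second term forces every diameter in the cover below \<open>min 1 d\<close>.\<close>
      define h where "h = min e (min 1 d powr t)"
      have "0 < h" using \<open>0 < d\<close> \<open>0 < e\<close> by (auto simp: h_def)
      then have "hausdorff_premeasure t D A < ennreal h" using 0 by simp
      then obtain U where U: "A \<subseteq> (\<Union>i. U i)" "\<And>i. bounded (U i)"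
        and sum: "(\<Sum>i. hausdorff_gauge t (U i)) < ennreal h"
        by (rule hausdorff_premeasure_less_cover) blast
      have dm: "diameter (U i) \<le> min 1 d" for i
      proof (rule ccontr)
        assume "\<not> ?thesis"
        then have "min 1 d powr t < diameter (U i) powr t"
          using \<open>0 < d\<close> \<open>0 < t\<close> by (intro powr_less_mono2) auto
        then have "ennreal h \<le> hausdorff_gauge t (U i)"
          using \<open>0 < t\<close> by (simp add: hausdorff_gauge_eq_powr h_def ennreal_leI)
        also have "\<dots> \<le> (\<Sum>i. hausdorff_gauge t (U i))"
          using sum_le_suminf[of "\<lambda>i. hausdorff_gauge t (U i)" "{i}"] by simp
        finally show False using sum by simp
      qed
      have "hausdorff_premeasure s d A \<le> (\<Sum>i. hausdorff_gauge s (U i))"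
        by (rule hausdorff_premeasure_le_cover) (use U dm in auto)
      also have "\<dots> \<le> (\<Sum>i. hausdorff_gauge t (U i))"
      proof (intro suminf_le allI)
        fix i
        have "diameter (U i) powr s \<le> diameter (U i) powr t"
          using dm[of i] diameter_ge_0[OF U(2)[of i]] assms by (intro powr_mono') auto
        then show "hausdorff_gauge s (U i) \<le> hausdorff_gauge t (U i)"
          using assms by (simp add: hausdorff_gauge_eq_powr ennreal_leI)
      qed auto
      also have "\<dots> \<le> ennreal h" using sum by simp
      also have "\<dots> \<le> 0 + ennreal e" by (simp add: h_def ennreal_leI)
      finally show ?thesis .
    qed
    then have "hausdorff_premeasure s d A \<le> 0"
      by (rule ennreal_le_epsilon)
    then show ?thesis by simp
  qed
  then have "hausdorff_measure s A = 0" by (simp add: hausdorff_measure_eq_0_iff)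
  with assms show False by simp
qed

lemma hausdorff_measure_lipschitz_pos:
  assumes pos: "0 < hausdorff_measure s (f ` A)" and lip: "L-lipschitz_on A f" and "0 < L" "0 < s"
  shows "0 < hausdorff_measure s A"
proof (rule ccontr)
  assume "\<not> ?thesis"
  then have 0: "\<And>d. 0 < d \<Longrightarrow> hausdorff_premeasure s d A = 0"
    using hausdorff_measure_eq_0_iff not_gr_zero by metis
  have *: "hausdorff_premeasure s d (f ` A) \<le> 0 + ennreal e" if "0 < d" "0 < e" for d e
  proof -
    have "hausdorff_premeasure s (d / L) A < ennreal (e / L powr s)"
      using 0[of "d / L"] that \<open>0 < L\<close> by simp
    then obtain U where U: "A \<subseteq> (\<Union>i. U i)" "\<And>i. bounded (U i)" "\<And>i. diameter (U i) \<le> d / L"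
      and sum: "(\<Sum>i. hausdorff_gauge s (U i)) < ennreal (e / L powr s)"
      by (rule hausdorff_premeasure_less_cover) auto
    have dist: "dist y z \<le> L * diameter (U i)" if "y \<in> f ` (A \<inter> U i)" "z \<in> f ` (A \<inter> U i)" for y z i
      using that lipschitz_onD[OF lip] diameter_bounded_bound[OF U(2)] \<open>0 < L\<close>
      by (smt (verit, best) IntE imageE mult_left_mono)
    have bd: "bounded (f ` (A \<inter> U i))" for i
      unfolding bounded_two_points using dist by blast
    have dm: "diameter (f ` (A \<inter> U i)) \<le> L * diameter (U i)" for i
    proof (cases "f ` (A \<inter> U i) = {}")
      case True
      then show ?thesis using diameter_ge_0[OF U(2)[of i]] \<open>0 < L\<close> by (metis diameter_empty mult_nonneg_nonneg less_imp_le)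
    next
      case False
      then have "(SUP (y, z) \<in> f ` (A \<inter> U i) \<times> f ` (A \<inter> U i). dist y z) \<le> L * diameter (U i)"
        using dist by (intro cSUP_least) auto
      then show ?thesis using False by (simp add: diameter_def[of "f ` (A \<inter> U i)"])
    qed
    have "hausdorff_premeasure s d (f ` A) \<le> (\<Sum>i. hausdorff_gauge s (f ` (A \<inter> U i)))"
    proof (rule hausdorff_premeasure_le_cover)
      show "f ` A \<subseteq> (\<Union>i. f ` (A \<inter> U i))" using U(1) by blast
      show "diameter (f ` (A \<inter> U i)) \<le> d" for i
        using dm[of i] U(3)[of i] \<open>0 < L\<close> by (simp add: field_simps)
    qed (rule bd)
    also have "\<dots> \<le> (\<Sum>i. ennreal (L powr s) * hausdorff_gauge s (U i))"
    proof (intro suminf_le allI)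
      fix i
      have "diameter (f ` (A \<inter> U i)) powr s \<le> (L * diameter (U i)) powr s"
        using dm[of i] diameter_ge_0[OF bd[of i]] \<open>0 < s\<close> by (intro powr_mono2) auto
      also have "\<dots> = L powr s * diameter (U i) powr s"
        using diameter_ge_0[OF U(2)[of i]] \<open>0 < L\<close> by (simp add: powr_mult)
      finally show "hausdorff_gauge s (f ` (A \<inter> U i)) \<le> ennreal (L powr s) * hausdorff_gauge s (U i)"
        using \<open>0 < s\<close> by (simp add: hausdorff_gauge_eq_powr ennreal_mult'[symmetric] ennreal_leI)
    qed auto
    also have "\<dots> = ennreal (L powr s) * (\<Sum>i. hausdorff_gauge s (U i))"
      by simp
    also have "\<dots> \<le> ennreal (L powr s) * ennreal (e / L powr s)"
      using sum by (intro mult_left_mono) auto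
    also have "\<dots> = ennreal e"
      using \<open>0 < L\<close> \<open>0 < e\<close> by (simp add: ennreal_mult'[symmetric])
    finally show ?thesis by simp
  qed
  have "hausdorff_premeasure s d (f ` A) \<le> 0" if "0 < d" for d
    by (rule ennreal_le_epsilon) (rule *[OF that])
  then have "hausdorff_measure s (f ` A) = 0" by (simp add: hausdorff_measure_eq_0_iff)
  with pos show False by simp
qed

text \<open>The inverse of \<open>f\<close> is Lipschitz.\<close>

lemma hausdorff_measure_expanding_pos:
  assumes "0 < hausdorff_measure s A" "0 < L" "0 < s"
    and exp: "\<And>x y. x \<in> A \<Longrightarrow> y \<in> A \<Longrightarrow> dist x y \<le> L * dist (f x) (f y)"
  shows "0 < hausdorff_measure s (f ` A)"
proof -
  have inj: "inj_on f A" using exp by (force intro: inj_onI)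
  have "L-lipschitz_on (f ` A) (inv_into A f)"
    by (rule lipschitz_onI) (use assms(2) exp inj in auto)
  moreover have "inv_into A f ` f ` A = A" using inj by (rule inv_into_image_cancel) simp
  ultimately show ?thesis
    using hausdorff_measure_lipschitz_pos[of s "inv_into A f" "f ` A" L] assms by simp
qed

section \<open>Discretisation of slopes and intercepts\<close>

lemma sum_telescope_int:
  fixes g :: "int \<Rightarrow> real"
  assumes "a \<le> b"
  shows "(\<Sum>j\<in>{a..<b}. g (j + 1) - g j) = g b - g a"
  using assms
proof (induction b rule: int_ge_induct)
  case (step i)
  have "{a..<i + 1} = insert i {a..<i}" using step by auto
  then show ?case using step by simp
qed simp

lemma exists_grid_cell:
  fixes x d :: real
  assumes "0 < d"
  obtains j :: int where "of_int j * d < x" "x \<le> of_int (j + 1) * d"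
proof
  have "of_int (\<lceil>x / d\<rceil> - 1) < x / d" "x / d \<le> of_int ((\<lceil>x / d\<rceil> - 1) + 1)"
    by linarith+
  then show "of_int (\<lceil>x / d\<rceil> - 1) * d < x" "x \<le> of_int ((\<lceil>x / d\<rceil> - 1) + 1) * d"
    using assms by (simp_all only: pos_less_divide_eq pos_divide_le_eq)
qed

text \<open>On the line a Frostman measure can be written down. Let \<open>G t\<close> be the \<open>s\<close>-dimensional content of
\<open>A \<inter> {..t}\<close>. Subadditivity of the content gives \<open>G u - G t \<le> (u - t) powr s\<close> and
also shows that \<open>G\<close> is constant on intervals that miss \<open>A\<close>. The increments of \<open>G\<close> over a
grid of mesh \<open>d\<close> are therefore weights on grid cells that meet \<open>A\<close>, their sum is the content of \<open>A\<close>, and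
\<open>r\<close>-balls carry at most about \<open>r powr s\<close>. The term \<open>2 * d\<close> pays for the two cells at the ends of
the ball.\<close>

lemma discrete_frostman:
  fixes A :: "real set"
  assumes s: "0 < s" and A: "A \<subseteq> {-R..R}" and D: "2 * R \<le> D" "0 \<le> R" and d: "0 < d"
    and c: "ennreal c < hausdorff_premeasure s D A"
  shows "\<exists>(J :: int set) y w. finite J \<and> (\<forall>j\<in>J. y j \<in> A) \<and> (\<forall>j\<in>J. 0 \<le> w j) \<and> c \<le> sum w J \<and>
    (\<forall>x r. 0 \<le> r \<longrightarrow> (\<Sum>j\<in>{j\<in>J. \<bar>y j - x\<bar> \<le> r}. w j) \<le> (2 * r + 2 * d) powr s)"
proof -
  let ?H = "hausdorff_premeasure s D"
  define G where "G = (\<lambda>t. enn2real (?H (A \<inter> {..t})))"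
  have D0: "0 \<le> D" using D by simp
  have fin: "?H B < top" if "B \<subseteq> A" for B
    using hausdorff_premeasure_interval[of s B "-R" R D] that A D s
    by (smt (verit) ennreal_less_top le_less_trans subset_trans)
  have GH: "ennreal (G t) = ?H (A \<inter> {..t})" for t
    unfolding G_def using fin[of "A \<inter> {..t}"] by simp
  have mono: "G t \<le> G u" if "t \<le> u" for t u
    unfolding G_def using that fin by (intro enn2real_mono hausdorff_premeasure_mono) auto
  have incr: "ennreal (G u) \<le> ennreal (G t) + ?H (A \<inter> {t<..u})" if "t \<le> u" for t u
  proof -
    have "A \<inter> {..u} = (A \<inter> {..t}) \<union> (A \<inter> {t<..u})" using that by auto
    then show ?thesis unfolding GH using hausdorff_premeasure_Un[OF D0] by metis
  qed
  have G0: "0 \<le> G t" for t by (simp add: G_def)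
  have holder: "G u - G t \<le> (u - t) powr s" if "t \<le> u" for t u
  proof -
    have "?H (A \<inter> {t<..u}) \<le> ennreal ((u - t) powr s)"
    proof (cases "u - t \<le> D")
      case True
      have "A \<inter> {t<..u} \<subseteq> {t..u}" by auto
      from hausdorff_premeasure_interval[OF s this that True] show ?thesis .
    next
      case False
      have "?H (A \<inter> {t<..u}) \<le> ennreal ((R - (-R)) powr s)"
        by (rule hausdorff_premeasure_interval) (use s A D in auto)
      also have "\<dots> \<le> ennreal ((u - t) powr s)"
        using False D s by (intro ennreal_leI powr_mono2) auto
      finally show ?thesis .
    qed
    then have "ennreal (G u) \<le> ennreal (G t) + ennreal ((u - t) powr s)"
      using incr[OF that] by (meson add_left_mono order_trans)
    also have "\<dots> = ennreal (G t + (u - t) powr s)" using G0 by simp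
    finally show ?thesis using G0 by (subst (asm) ennreal_le_iff) auto
  qed
  define w where "w = (\<lambda>j::int. G (of_int (j + 1) * d) - G (of_int j * d))"
  have w0: "0 \<le> w j" for j
    unfolding w_def using mono d by (simp add: mult_right_mono)
  have tel: "(\<Sum>j\<in>{a..<b}. w j) = G (of_int b * d) - G (of_int a * d)" if "a \<le> b" for a b
    unfolding w_def using sum_telescope_int[OF that, of "\<lambda>j. G (of_int j * d)"] by simp
  \<comment> \<open>The cells with index in \<open>{-N..<N}\<close> cover \<open>{-R..R}\<close>.\<close>
  define N where "N = \<lceil>R / d\<rceil> + 1"
  have N: "R < of_int N * d" "0 \<le> N"
  proof -
    have "R / d < of_int N" unfolding N_def by linarith
    then show "R < of_int N * d" using d by (simp add: field_simps)
    have "0 \<le> R / d" using D d by simp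
    then show "0 \<le> N" unfolding N_def by linarith
  qed
  define J where "J = {-N..<N} \<inter> {j. w j \<noteq> 0}"
  have finJ: "finite J" by (simp add: J_def)
  have "\<exists>y. y \<in> A \<and> of_int j * d < y \<and> y \<le> of_int (j + 1) * d" if "j \<in> J" for j
  proof (rule ccontr)
    assume "\<not> ?thesis"
    then have "A \<inter> {of_int j * d<..of_int (j + 1) * d} = {}" by force
    then have "ennreal (G (of_int (j + 1) * d)) \<le> ennreal (G (of_int j * d))"
      using incr[of "of_int j * d" "of_int (j + 1) * d"] d D0
      by (simp add: hausdorff_premeasure_empty mult_right_mono)
    then have "w j \<le> 0" unfolding w_def using G0 by (simp add: ennreal_le_iff)
    with w0[of j] that show False by (simp add: J_def)
  qed
  then obtain y where y: "\<And>j. j \<in> J \<Longrightarrow> y j \<in> A"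
    "\<And>j. j \<in> J \<Longrightarrow> of_int j * d < y j" "\<And>j. j \<in> J \<Longrightarrow> y j \<le> of_int (j + 1) * d"
    by metis
  show ?thesis
  proof (rule exI[of _ J], rule exI[of _ y], rule exI[of _ w], intro conjI ballI allI impI)
    show "finite J" by (fact finJ)
    have "A \<inter> {..of_int N * d} = A" "A \<inter> {..of_int (-N) * d} = {}" using A N by fastforce+
    then have "ennreal c < ennreal (G (of_int N * d))" "G (of_int (-N) * d) = 0"
      using c GH[of "of_int N * d"] D0 by (simp_all add: G_def hausdorff_premeasure_empty)
    then have "c \<le> G (of_int N * d) - G (of_int (-N) * d)"
      by (metis G0 diff_zero ennreal_less_iff ennreal_neg less_imp_le linorder_not_le order_trans)
    also have "\<dots> = (\<Sum>j\<in>{-N..<N}. w j)" using tel[of "-N" N] N by simp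
    also have "\<dots> = sum w J" by (rule sum.mono_neutral_right) (auto simp: J_def)
    finally show "c \<le> sum w J" .
    fix x r :: real
    assume "0 \<le> r"
    let ?K = "{j\<in>J. \<bar>y j - x\<bar> \<le> r}"
    show "sum w ?K \<le> (2 * r + 2 * d) powr s"
    proof (cases "?K = {}")
      case False
      have finK: "finite ?K" using finJ by simp
      define a b where "a = Min ?K" and "b = Max ?K"
      have "a \<in> ?K" "b \<in> ?K" using Min_in[OF finK False] Max_in[OF finK False] by (simp_all only: a_def b_def)
      have sub: "?K \<subseteq> {a..<b + 1}"
        using Min_le[OF finK] Max_ge[OF finK] by (force simp: a_def b_def)
      then have "a \<le> b" using \<open>a \<in> ?K\<close> by auto
      have "sum w ?K \<le> (\<Sum>j\<in>{a..<b + 1}. w j)"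
        by (rule sum_mono2) (use sub w0 in auto)
      also have "\<dots> = G (of_int (b + 1) * d) - G (of_int a * d)"
        using \<open>a \<le> b\<close> by (intro tel) simp
      also have "\<dots> \<le> (of_int (b + 1) * d - of_int a * d) powr s"
        using \<open>a \<le> b\<close> d by (intro holder mult_right_mono) auto
      also have "\<dots> \<le> (2 * r + 2 * d) powr s"
      proof (rule powr_mono2)
        have "of_int b * d < x + r" "x - r \<le> of_int (a + 1) * d"
          using y(2)[of b] y(3)[of a] \<open>a \<in> ?K\<close> \<open>b \<in> ?K\<close> by auto
        then show "of_int (b + 1) * d - of_int a * d \<le> 2 * r + 2 * d"
          by (simp add: algebra_simps)
        show "0 \<le> of_int (b + 1) * d - of_int a * d"
          using \<open>a \<le> b\<close> d by (simp add: mult_right_mono)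
      qed (use s in auto)
      finally show ?thesis .
    next
      case True
      show ?thesis unfolding True using d \<open>0 \<le> r\<close> by simp
    qed
  qed (use w0 y in auto)
qed

text \<open>The set of slopes is treated more crudely: a set of positive one-dimensional content meets
at least about \<open>1 / d\<close> cells of the grid of mesh \<open>d\<close>, and one point is chosen in each. The grid
indices are kept because differences of slopes are measured by them.\<close>

lemma separated_slopes:
  fixes M :: "real set"
  assumes M: "M \<subseteq> {-1..1}" and D: "0 < d" "d \<le> D" and c: "ennreal c < hausdorff_premeasure 1 D M"
  obtains I :: "int set" and m :: "int \<Rightarrow> real" where
    "finite I" "\<And>i. i \<in> I \<Longrightarrow> m i \<in> M" "c \<le> real (card I) * d"
    "\<And>i. i \<in> I \<Longrightarrow> of_int i * d < m i" "\<And>i. i \<in> I \<Longrightarrow> m i \<le> of_int (i + 1) * d"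
proof -
  let ?cell = "\<lambda>i::int. {of_int i * d..of_int (i + 1) * d}"
  define I where "I = {i::int. \<exists>x\<in>M. of_int i * d < x \<and> x \<le> of_int (i + 1) * d}"
  then have "\<forall>i\<in>I. \<exists>x. x \<in> M \<and> of_int i * d < x \<and> x \<le> of_int (i + 1) * d" by auto
  then obtain m where m: "\<And>i. i \<in> I \<Longrightarrow> m i \<in> M"
    "\<And>i. i \<in> I \<Longrightarrow> of_int i * d < m i" "\<And>i. i \<in> I \<Longrightarrow> m i \<le> of_int (i + 1) * d"
    by metis
  have "I \<subseteq> {-\<lceil>1/d\<rceil> - 1..\<lceil>1/d\<rceil>}"
  proof
    fix i assume "i \<in> I"
    then have "of_int i * d < 1" "-1 \<le> of_int (i + 1) * d" using m[of i] M by fastforce+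
    then have "of_int i < 1 / d" "-(1 / d) \<le> of_int (i + 1)"
      using D by (simp_all add: field_simps)
    then show "i \<in> {-\<lceil>1/d\<rceil> - 1..\<lceil>1/d\<rceil>}" by simp linarith
  qed
  then have fin: "finite I" by (rule finite_subset) simp
  have "M \<subseteq> (\<Union>i\<in>I. ?cell i)"
  proof
    fix x assume "x \<in> M"
    moreover obtain i :: int where "of_int i * d < x" "x \<le> of_int (i + 1) * d"
      using exists_grid_cell[OF D(1)] .
    ultimately have "i \<in> I" "x \<in> ?cell i" by (auto simp: I_def)
    then show "x \<in> (\<Union>i\<in>I. ?cell i)" by blast
  qed
  then have "hausdorff_premeasure 1 D M \<le> hausdorff_premeasure 1 D (\<Union>i\<in>I. ?cell i)"
    by (rule hausdorff_premeasure_mono)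
  also have "\<dots> \<le> (\<Sum>i\<in>I. hausdorff_premeasure 1 D (?cell i))"
    by (rule hausdorff_premeasure_finite_UN) (use fin D in auto)
  also have "\<dots> \<le> (\<Sum>i\<in>I. ennreal d)"
  proof (rule sum_mono)
    fix i
    have "of_int (i + 1) * d - of_int i * d = d" by (simp add: algebra_simps)
    then show "hausdorff_premeasure 1 D (?cell i) \<le> ennreal d"
      using hausdorff_premeasure_interval[of 1 "?cell i" "of_int i * d" "of_int (i + 1) * d" D] D
      by (simp add: mult_right_mono)
  qed
  also have "\<dots> = ennreal (real (card I) * d)"
    using D by (simp add: ennreal_mult' ennreal_of_nat_eq_real_of_nat)
  finally have "ennreal c < ennreal (real (card I) * d)" using c by simp
  then have "c \<le> real (card I) * d"
    by (metis ennreal_leI linorder_not_le less_imp_le)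
  with fin m show thesis using that by blast
qed

text \<open>Comparison with \<open>\<integral> x powr (s - 1)\<close>; that this integral converges at \<open>0\<close> for \<open>s > 0\<close> is the reason for
the absence of a logarithm in the final energy bound.\<close>

lemma powr_sum_le:
  fixes s :: real
  assumes "0 < s" "s \<le> 1"
  shows "(\<Sum>k=1..n. real k powr (s - 1)) \<le> real n powr s / s"
proof (induction n)
  case (Suc n)
  have "real (Suc n) powr (s - 1) \<le> (real (Suc n) powr s - real n powr s) / s"
  proof (cases "n = 0")
    case True
    then show ?thesis using assms by simp
  next
    case False
    have "\<exists>z>real n. z < real (Suc n) \<and>
        real (Suc n) powr s - real n powr s = (real (Suc n) - real n) * (s * z powr (s - 1))"
      using False by (intro MVT2) (auto intro!: derivative_eq_intros)
    then obtain z where z: "real n < z" "z < real (Suc n)"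
      "real (Suc n) powr s - real n powr s = s * z powr (s - 1)" by auto
    have "real (Suc n) powr (s - 1) \<le> z powr (s - 1)"
      using z assms by (intro powr_mono2') auto
    then show ?thesis using z(3) assms by simp
  qed
  with Suc show ?case by (simp add: diff_divide_distrib)
qed simp

text \<open>The maximum with \<open>1\<close> treats the diagonal term \<open>j = i\<close> like its neighbours.\<close>

lemma powr_sum_int_le:
  fixes s :: real and I :: "int set"
  assumes s: "0 < s" "s \<le> 1" and I: "finite I" "\<And>j. j \<in> I \<Longrightarrow> \<bar>j - i\<bar> \<le> int N" and N: "1 \<le> N"
  shows "(\<Sum>j\<in>I. (max 1 \<bar>of_int (j - i)\<bar>) powr (s - 1)) \<le> 3 * real N powr s / s"
proof -
  let ?f = "\<lambda>j::int. (max 1 \<bar>of_int (j - i)\<bar> :: real) powr (s - 1)"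
  let ?u = "\<lambda>k::nat. i + int k" and ?l = "\<lambda>k::nat. i - int k"
  have Un: "sum ?f (A \<union> B) \<le> sum ?f A + sum ?f B" if "finite A" "finite B" for A B
  proof -
    have "0 \<le> sum ?f (A \<inter> B)" by (intro sum_nonneg) simp
    then show ?thesis using sum.union_inter[OF that, of ?f] by linarith
  qed
  have "I \<subseteq> {i} \<union> ?u ` {1..N} \<union> ?l ` {1..N}"
  proof
    fix j assume "j \<in> I"
    have "j = ?u (nat (j - i))" if "i < j" using that by simp
    moreover have "j = ?l (nat (i - j))" if "j < i" using that by simp
    ultimately show "j \<in> {i} \<union> ?u ` {1..N} \<union> ?l ` {1..N}"
      using I(2)[OF \<open>j \<in> I\<close>]
      by (cases i j rule: linorder_cases)
        (auto intro!: image_eqI[of _ ?u "nat (j - i)"] image_eqI[of _ ?l "nat (i - j)"])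
  qed
  then have "sum ?f I \<le> sum ?f ({i} \<union> ?u ` {1..N} \<union> ?l ` {1..N})"
    by (intro sum_mono2) auto
  also have "\<dots> \<le> sum ?f {i} + sum ?f (?u ` {1..N}) + sum ?f (?l ` {1..N})"
    using Un[of "{i} \<union> ?u ` {1..N}" "?l ` {1..N}"] Un[of "{i}" "?u ` {1..N}"] by simp
  also have "sum ?f (?u ` {1..N}) = (\<Sum>k=1..N. real k powr (s - 1))"
    by (subst sum.reindex) (auto simp: inj_on_def max_def intro!: sum.cong)
  also have "sum ?f (?l ` {1..N}) = (\<Sum>k=1..N. real k powr (s - 1))"
    by (subst sum.reindex) (auto simp: inj_on_def max_def intro!: sum.cong)
  also have "sum ?f {i} + (\<Sum>k=1..N. real k powr (s - 1)) + (\<Sum>k=1..N. real k powr (s - 1))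
      \<le> 1 + real N powr s / s + real N powr s / s"
    using powr_sum_le[OF s, of N] by simp
  also have "1 \<le> real N powr s / s"
    using s N ge_one_powr_ge_zero[of "real N" s] by (simp add: field_simps)
  finally show ?thesis by simp
qed

section \<open>Overlap of strips\<close>

text \<open>Cauchy-Schwarz for \<open>f = (\<Sum>i. u i * indicator (T i))\<close>, which vanishes outside \<open>U\<close>: if the sets \<open>T i\<close>
overlap little on average, then \<open>U\<close> cannot be small.\<close>

lemma cauchy_schwarz_overlap:
  fixes T :: "'i \<Rightarrow> 'a set"
  assumes fin: "finite I" and T: "\<And>i. i \<in> I \<Longrightarrow> T i \<in> fmeasurable M" "\<And>i. i \<in> I \<Longrightarrow> T i \<subseteq> U"
    and U: "U \<in> fmeasurable M"
  shows "(\<Sum>i\<in>I. u i * measure M (T i))\<^sup>2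
    \<le> measure M U * (\<Sum>i\<in>I. \<Sum>j\<in>I. u i * u j * measure M (T i \<inter> T j))"
proof -
  define a where "a = (\<Sum>i\<in>I. u i * measure M (T i))"
  define B where "B = (\<Sum>i\<in>I. \<Sum>j\<in>I. u i * u j * measure M (T i \<inter> T j))"
  define f where "f = (\<lambda>x. \<Sum>i\<in>I. u i * indicator (T i) x :: real)"
  have int: "integrable M (indicator S :: 'a \<Rightarrow> real)" if "S \<in> fmeasurable M" for S
    using that by (simp add: fmeasurable_def)
  have TT: "T i \<inter> T j \<in> fmeasurable M" if "i \<in> I" "j \<in> I" for i j
    using T that by (simp add: fmeasurable_Int_fmeasurable fmeasurableD)
  have meas: "(\<integral>x. indicator S x \<partial>M) = measure M S" if "S \<in> fmeasurable M" for S
    using that by (simp add: fmeasurable_def)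
  \<comment> \<open>The quadratic polynomial is the integral of \<open>(f - l * indicator U)\<^sup>2\<close>.\<close>
  have q: "0 \<le> B - 2 * l * a + l\<^sup>2 * measure M U" for l
  proof -
    have eq: "(f x - l * indicator U x)\<^sup>2 =
        (\<Sum>i\<in>I. \<Sum>j\<in>I. u i * u j * indicator (T i \<inter> T j) x)
        - (\<Sum>i\<in>I. 2 * l * u i * indicator (T i) x) + l\<^sup>2 * indicator U x" for x
    proof -
      have "f x * indicator U x = f x"
        unfolding f_def sum_distrib_right
        by (intro sum.cong) (use T in \<open>auto split: split_indicator\<close>)
      then have "(f x - l * indicator U x)\<^sup>2 = f x * f x - 2 * l * f x + l\<^sup>2 * indicator U x"
        by (simp add: power2_eq_square algebra_simps indicator_inter_arith[symmetric])
      also have "f x * f x = (\<Sum>i\<in>I. \<Sum>j\<in>I. u i * u j * indicator (T i \<inter> T j) x)"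
        unfolding f_def sum_product by (simp add: indicator_inter_arith mult_ac)
      also have "2 * l * f x = (\<Sum>i\<in>I. 2 * l * u i * indicator (T i) x)"
        unfolding f_def sum_distrib_left by (simp add: mult_ac)
      finally show ?thesis .
    qed
    have "0 \<le> (\<integral>x. (f x - l * indicator U x)\<^sup>2 \<partial>M)" by simp
    also have "\<dots> = (\<Sum>i\<in>I. \<Sum>j\<in>I. u i * u j * measure M (T i \<inter> T j))
        - (\<Sum>i\<in>I. 2 * l * u i * measure M (T i)) + l\<^sup>2 * measure M U"
      unfolding eq using T U TT
      by (simp add: int meas integrable_sum del: indicator_inter_arith)
    also have "\<dots> = B - 2 * l * a + l\<^sup>2 * measure M U"
      by (simp add: a_def B_def sum_distrib_left mult_ac)
    finally show ?thesis .
  qed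
  have "a\<^sup>2 \<le> measure M U * B"
  proof (cases "measure M U = 0")
    case True
    have "a = 0"
    proof (rule ccontr)
      assume "a \<noteq> 0"
      then show False using q[of "(B + 1) / (2 * a)"] True by simp
    qed
    then show ?thesis using True by simp
  next
    case False
    then have "0 < measure M U" by (simp add: zero_less_measure_iff)
    then show ?thesis using q[of "a / measure M U"]
      by (simp add: field_simps power2_eq_square)
  qed
  then show ?thesis by (simp add: a_def B_def)
qed

text \<open>Thickening the segment over \<open>{p..q}\<close> of the line with slope \<open>m\<close> and intercept \<open>c\<close> in the vertical direction,
rather than to a Euclidean tube, makes the strip an exact sheared rectangle.\<close>

definition strip :: "real \<Rightarrow> real \<Rightarrow> real \<Rightarrow> real \<Rightarrow> real \<Rightarrow> (real^2) set" where
  "strip p q d m c = {z. p \<le> z$1 \<and> z$1 \<le> q \<and> \<bar>z$2 - m * z$1 - c\<bar> \<le> d}"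

lemma matrix_2:
  "matrix (\<lambda>z::real^2. vector [a * z$1 + b * z$2, a' * z$1 + b' * z$2] :: real^2) =
    vector [vector [a, b], vector [a', b']]"
  by (simp add: vec_eq_iff forall_2 matrix_def axis_def)

lemma linear_2: "linear (\<lambda>z::real^2. vector [a * z$1 + b * z$2, a' * z$1 + b' * z$2] :: real^2)"
  by (rule linearI) (simp_all add: vec_eq_iff forall_2 algebra_simps)

lemma measure_linear_image_2:
  assumes "S \<in> lmeasurable"
  shows "measure lebesgue ((\<lambda>z::real^2. vector [a * z$1 + b * z$2, a' * z$1 + b' * z$2] :: real^2) ` S)
    = \<bar>a * b' - b * a'\<bar> * measure lebesgue S"
  by (subst measure_linear_image[OF linear_2 assms]) (simp add: matrix_2 det_2)

lemma measure_cbox_2: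
  assumes "a \<le> b" "c \<le> d"
  shows "measure lborel (cbox (vector [a, c]) (vector [b, d] :: real^2)) = (b - a) * (d - c)"
proof -
  have "vector [a, c] \<in> cbox (vector [a, c]) (vector [b, d] :: real^2)"
    using assms by (simp add: mem_box_cart forall_2)
  then show ?thesis by (subst content_cbox_cart) (auto simp: UNIV_2)
qed

lemma strip_eq_shear:
  "strip p q d m c = (\<lambda>z::real^2. vector [1 * z$1 + 0 * z$2, m * z$1 + 1 * z$2] :: real^2) ` cbox (vector [p, c - d]) (vector [q, c + d])"
  (is "_ = ?f ` _")
proof -
  have "z \<in> ?f ` cbox (vector [p, c - d]) (vector [q, c + d])" if "z \<in> strip p q d m c" for z
    by (rule image_eqI[of _ _ "vector [z$1, z$2 - m * z$1]"])
      (use that in \<open>auto simp: strip_def vec_eq_iff forall_2 mem_box_cart\<close>)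
  then show ?thesis by (auto simp: strip_def mem_box_cart forall_2)
qed

lemma strip_lmeasurable: "strip p q d m c \<in> lmeasurable"
  unfolding strip_eq_shear by (rule measurable_linear_image[OF linear_2]) simp

lemma measure_strip:
  assumes "p \<le> q" "0 \<le> d"
  shows "measure lebesgue (strip p q d m c) = 2 * d * (q - p)"
  unfolding strip_eq_shear using assms
  by (subst measure_linear_image_2) (auto simp: measure_cbox_2)

text \<open>The linear map \<open>z \<mapsto> (z$2 - m * z$1, z$2 - m' * z$1)\<close> has determinant of modulus \<open>\<bar>m - m'\<bar>\<close> and sends the
intersection into a square of side \<open>2 * d\<close>.\<close>

lemma measure_strip_Int_le:
  assumes "0 \<le> d"
  shows "\<bar>m - m'\<bar> * measure lebesgue (strip p q d m c \<inter> strip p q d m' c') \<le> 4 * d\<^sup>2"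
proof -
  let ?S = "strip p q d m c \<inter> strip p q d m' c'"
  let ?f = "\<lambda>z::real^2. vector [(-m) * z$1 + 1 * z$2, (-m') * z$1 + 1 * z$2] :: real^2"
  have S: "?S \<in> lmeasurable" by (simp add: strip_lmeasurable fmeasurable.Int)
  have "\<bar>m - m'\<bar> * measure lebesgue ?S = measure lebesgue (?f ` ?S)"
    unfolding measure_linear_image_2[OF S] by (simp add: abs_minus_commute)
  also have "\<dots> \<le> measure lebesgue (cbox (vector [c - d, c' - d]) (vector [c + d, c' + d] :: real^2))"
  proof (rule measure_mono_fmeasurable)
    show "?f ` ?S \<subseteq> cbox (vector [c - d, c' - d]) (vector [c + d, c' + d])"
      by (auto simp: strip_def mem_box_cart forall_2)
    show "?f ` ?S \<in> sets lebesgue"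
      by (intro fmeasurableD measurable_linear_image linear_2 S)
  qed simp
  also have "\<dots> = 4 * d\<^sup>2" using assms by (simp add: measure_cbox_2 power2_eq_square)
  finally show ?thesis .
qed

text \<open>This is where positive dimension of the families enters: a strip whose slope differs by \<open>r\<close> can meet a
given strip inside the bounded window only if its intercept lies in an interval of length comparable
to \<open>r\<close>, and such an interval carries only weight about \<open>r powr s\<close>.\<close>

lemma strips_meet_imp_intercepts_close:
  assumes "strip p q d m c \<inter> strip p q d m' c' \<noteq> {}" "\<bar>p\<bar> \<le> R" "\<bar>q\<bar> \<le> R"
  shows "\<bar>c' - c\<bar> \<le> \<bar>m - m'\<bar> * R + 2 * d"
proof -
  obtain z :: "real^2" where z: "p \<le> z$1" "z$1 \<le> q" "\<bar>z$2 - m * z$1 - c\<bar> \<le> d" "\<bar>z$2 - m' * z$1 - c'\<bar> \<le> d"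
    using assms(1) by (auto simp: strip_def)
  have "\<bar>(m - m') * z$1\<bar> \<le> \<bar>m - m'\<bar> * R"
    unfolding abs_mult using z assms by (intro mult_left_mono) auto
  moreover have "c' - c = (z$2 - m * z$1 - c) - (z$2 - m' * z$1 - c') + (m - m') * z$1"
    by (simp add: algebra_simps)
  ultimately show ?thesis using z by linarith
qed

lemma grid_slopes_diff:
  fixes d x y :: real and i j :: int
  assumes "0 < d" "of_int i * d < x" "x \<le> of_int (i + 1) * d"
    "of_int j * d < y" "y \<le> of_int (j + 1) * d"
  shows "\<bar>x - y\<bar> \<le> (\<bar>of_int (j - i)\<bar> + 1) * d" "(\<bar>of_int (j - i)\<bar> - 1) * d \<le> \<bar>x - y\<bar>"
proof -
  have "x - y \<le> (of_int (i - j) + 1) * d" "(of_int (i - j) - 1) * d \<le> x - y"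
    using assms by (simp_all add: algebra_simps)
  moreover have "(of_int (i - j) + 1) * d \<le> (\<bar>of_int (j - i)\<bar> + 1) * d"
    "(\<bar>of_int (j - i)\<bar> + 1) * d \<ge> (1 - of_int (i - j)) * d"
    using assms(1) by (auto intro!: mult_right_mono)
  ultimately show "\<bar>x - y\<bar> \<le> (\<bar>of_int (j - i)\<bar> + 1) * d"
    by (simp add: algebra_simps abs_le_iff)
  show "(\<bar>of_int (j - i)\<bar> - 1) * d \<le> \<bar>x - y\<bar>"
  proof (cases "j \<le> i")
    case True
    then have "\<bar>of_int (j - i)\<bar> = (of_int (i - j) :: real)" by simp
    then show ?thesis using \<open>(of_int (i - j) - 1) * d \<le> x - y\<close> by (simp only:)
  next
    case False
    then have "\<bar>of_int (j - i)\<bar> = (- of_int (i - j) :: real)" by simp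
    then show ?thesis using \<open>x - y \<le> (of_int (i - j) + 1) * d\<close>
      by (simp only:) (simp add: algebra_simps)
  qed
qed

text \<open>The right-hand factor of \<open>measure lebesgue U\<close> does not depend on \<open>d\<close>; this uniformity is the whole
point. The weight \<open>d * w i j\<close> of a strip combines the length carried by one slope cell with the Frostman
weight of the intercept. For a fixed strip and a second slope cell at index distance \<open>\<kappa>\<close>,
overlaps have area at most a constant times \<open>d / \<kappa>\<close>, and the strips that do overlap have total weight at most
a constant times \<open>(\<kappa> * d) powr s\<close>. Summing \<open>\<kappa> powr (s - 1)\<close> over at most about \<open>1 / d\<close> cells gives a
bound proportional to \<open>d\<close> for the weighted overlap of one strip with all the others, and
Cauchy-Schwarz concludes.\<close>

lemma strip_family_measure_lower_bound:
  fixes I :: "int set" and m :: "int \<Rightarrow> real" and J :: "int \<Rightarrow> int set" and y w :: "int \<Rightarrow> int \<Rightarrow> real"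
  assumes pq: "p < q" "\<bar>p\<bar> \<le> R" "\<bar>q\<bar> \<le> R" and s: "0 < s" "s \<le> 1" and d: "0 < d" "d \<le> 1"
    and I: "finite I" "\<And>i. i \<in> I \<Longrightarrow> m i \<in> {-1..1}"
      "\<And>i. i \<in> I \<Longrightarrow> of_int i * d < m i" "\<And>i. i \<in> I \<Longrightarrow> m i \<le> of_int (i + 1) * d"
    and J: "\<And>i. i \<in> I \<Longrightarrow> finite (J i)" "\<And>i j. i \<in> I \<Longrightarrow> j \<in> J i \<Longrightarrow> 0 \<le> w i j"
    and frostman: "\<And>i x r. i \<in> I \<Longrightarrow> 0 \<le> r \<Longrightarrow>
      (\<Sum>j\<in>{j\<in>J i. \<bar>y i j - x\<bar> \<le> r}. w i j) \<le> (2 * r + 2 * d) powr s"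
    and U: "U \<in> lmeasurable" "\<And>i j. i \<in> I \<Longrightarrow> j \<in> J i \<Longrightarrow> strip p q d (m i) (y i j) \<subseteq> U"
  shows "4 * (q - p)\<^sup>2 * (d * (\<Sum>i\<in>I. \<Sum>j\<in>J i. w i j))
    \<le> measure lebesgue U * (9 * (8 + 2 * (q - p)) * (4 * R + 6) powr s / s)"
proof -
  define \<Lambda> where "\<Lambda> = 8 + 2 * (q - p)"
  define C where "C = 4 * R + 6"
  define \<kappa> where "\<kappa> = (\<lambda>i j. max 1 \<bar>of_int (j - i)\<bar> :: real)" for i j :: int
  let ?T = "\<lambda>i j. strip p q d (m i) (y i j)"
  have R: "0 \<le> R" using pq by linarith
  have \<Lambda>: "0 < \<Lambda>" and C: "0 < C" using pq R by (auto simp: \<Lambda>_def C_def)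
  have \<kappa>: "1 \<le> \<kappa> i j" for i j by (simp add: \<kappa>_def)
  have \<kappa>': "\<bar>of_int (j - i)\<bar> \<le> \<kappa> i j" for i j by (simp add: \<kappa>_def)
  \<comment> \<open>For slopes in equal or adjacent cells the strips may coincide, and only the trivial bound is left.\<close>
  have overlap: "measure lebesgue (?T i j \<inter> ?T i' j') \<le> \<Lambda> * d / \<kappa> i i'"
    if "i \<in> I" "i' \<in> I" for i j i' j'
  proof (cases "\<bar>i' - i\<bar> \<le> 1")
    case True
    then have "\<kappa> i i' = 1" unfolding \<kappa>_def by linarith
    have "measure lebesgue (?T i j \<inter> ?T i' j') \<le> measure lebesgue (?T i j)"
      by (rule measure_mono_fmeasurable) (auto simp: strip_lmeasurable fmeasurableD)
    also have "\<dots> \<le> \<Lambda> * d"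
      using d pq by (simp add: measure_strip \<Lambda>_def algebra_simps)
    finally show ?thesis using \<open>\<kappa> i i' = 1\<close> by simp
  next
    case False
    let ?\<mu> = "measure lebesgue (?T i j \<inter> ?T i' j')"
    have k: "\<kappa> i i' = \<bar>of_int (i' - i)\<bar>" "2 \<le> \<kappa> i i'" using False unfolding \<kappa>_def by linarith+
    have "\<kappa> i i' / 2 * d \<le> (\<bar>of_int (i' - i)\<bar> - 1) * d"
      using k d by (intro mult_right_mono) auto
    also have "\<dots> \<le> \<bar>m i - m i'\<bar>" using grid_slopes_diff(2)[OF d(1)] I that by blast
    finally have "\<kappa> i i' / 2 * d * ?\<mu> \<le> \<bar>m i - m i'\<bar> * ?\<mu>" by (intro mult_right_mono) auto
    also have "\<dots> \<le> 4 * d\<^sup>2" using d by (intro measure_strip_Int_le) simp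
    finally have "\<kappa> i i' * ?\<mu> \<le> 8 * d" using d by (simp add: power2_eq_square field_simps)
    also have "8 * d \<le> \<Lambda> * d" using pq d by (auto simp: \<Lambda>_def intro!: mult_right_mono)
    finally show ?thesis using \<kappa>[of i i'] by (simp add: field_simps)
  qed
  have row: "(\<Sum>j'\<in>J i'. w i' j' * measure lebesgue (?T i j \<inter> ?T i' j'))
      \<le> \<Lambda> * C powr s * d powr (1 + s) * \<kappa> i i' powr (s - 1)"
    if i: "i \<in> I" and i': "i' \<in> I" for i j i'
  proof -
    define r where "r = \<bar>m i - m i'\<bar> * R + 2 * d"
    have r0: "0 \<le> r" using R d by (simp add: r_def)
    have "\<bar>m i - m i'\<bar> \<le> 2 * \<kappa> i i' * d"
    proof -
      have "\<bar>m i - m i'\<bar> \<le> (\<bar>of_int (i' - i)\<bar> + 1) * d"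
        using grid_slopes_diff(1)[OF d(1)] I that by blast
      also have "\<dots> \<le> 2 * \<kappa> i i' * d"
      proof (rule mult_right_mono)
        show "\<bar>of_int (i' - i)\<bar> + 1 \<le> 2 * \<kappa> i i'" using \<kappa>[of i i'] \<kappa>'[of i' i] by linarith
      qed (use d in simp)
      finally show ?thesis .
    qed
    then have "\<bar>m i - m i'\<bar> * R \<le> 2 * \<kappa> i i' * d * R" using R by (rule mult_right_mono)
    moreover have "6 * d \<le> 6 * (\<kappa> i i' * d)" using d \<kappa>[of i i'] by simp
    ultimately have r: "2 * r + 2 * d \<le> C * (\<kappa> i i' * d)"
      unfolding r_def C_def by (simp add: algebra_simps)
    have "(\<Sum>j'\<in>J i'. w i' j' * measure lebesgue (?T i j \<inter> ?T i' j'))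
        = (\<Sum>j'\<in>{j'\<in>J i'. \<bar>y i' j' - y i j\<bar> \<le> r}. w i' j' * measure lebesgue (?T i j \<inter> ?T i' j'))"
    proof (rule sum.mono_neutral_right)
      show "\<forall>j'\<in>J i' - {j'\<in>J i'. \<bar>y i' j' - y i j\<bar> \<le> r}. w i' j' * measure lebesgue (?T i j \<inter> ?T i' j') = 0"
      proof
        fix j' assume "j' \<in> J i' - {j'\<in>J i'. \<bar>y i' j' - y i j\<bar> \<le> r}"
        then have "?T i j \<inter> ?T i' j' = {}"
          using strips_meet_imp_intercepts_close[OF _ pq(2,3)] unfolding r_def by blast
        then show "w i' j' * measure lebesgue (?T i j \<inter> ?T i' j') = 0" by simp
      qed
    qed (use J i' in auto)
    also have "\<dots> \<le> (\<Sum>j'\<in>{j'\<in>J i'. \<bar>y i' j' - y i j\<bar> \<le> r}. w i' j' * (\<Lambda> * d / \<kappa> i i'))"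
      by (intro sum_mono mult_left_mono overlap) (use J i i' in auto)
    also have "\<dots> = (\<Sum>j'\<in>{j'\<in>J i'. \<bar>y i' j' - y i j\<bar> \<le> r}. w i' j') * (\<Lambda> * d / \<kappa> i i')"
      by (rule sum_distrib_right[symmetric])
    also have "\<dots> \<le> (2 * r + 2 * d) powr s * (\<Lambda> * d / \<kappa> i i')"
      using \<Lambda> d \<kappa>[of i i'] by (intro mult_right_mono frostman[OF i' r0]) auto
    also have "\<dots> \<le> (C * (\<kappa> i i' * d)) powr s * (\<Lambda> * d / \<kappa> i i')"
      using \<Lambda> d \<kappa>[of i i'] r r0 s by (intro mult_right_mono powr_mono2) auto
    also have "\<dots> = \<Lambda> * C powr s * d powr (1 + s) * \<kappa> i i' powr (s - 1)"
      using d \<kappa>[of i i'] C by (simp add: powr_mult powr_add powr_diff)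
    finally show ?thesis .
  qed
  define H where "H = 9 * \<Lambda> * C powr s / s"
  have column: "(\<Sum>i'\<in>I. \<Sum>j'\<in>J i'. w i' j' * measure lebesgue (?T i j \<inter> ?T i' j')) \<le> H * d"
    if i: "i \<in> I" for i j
  proof -
    \<comment> \<open>Slopes differ by at most \<open>2\<close>, and passing to cell indices costs at most \<open>d \<le> 1\<close>.\<close>
    define N where "N = nat \<lfloor>3 / d\<rfloor>"
    have "1 \<le> 3 / d" using d by (simp add: field_simps)
    then have N: "1 \<le> N" unfolding N_def by linarith
    have "real N \<le> 3 / d" unfolding N_def using d by simp
    then have Nd: "real N * d \<le> 3" using d by (simp add: field_simps)
    have dist: "\<bar>i' - i\<bar> \<le> int N" if "i' \<in> I" for i'
    proof -
      have "\<bar>m i - m i'\<bar> \<le> 2" using I(2)[OF i] I(2)[OF that] by auto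
      then have "(\<bar>of_int (i' - i)\<bar> - 1) * d \<le> 2"
        using grid_slopes_diff(2)[OF d(1) I(3)[OF i] I(4)[OF i] I(3)[OF that] I(4)[OF that]] by linarith
      then have "\<bar>of_int (i' - i)\<bar> * d \<le> 3" using d by (simp add: algebra_simps)
      then have "of_int \<bar>i' - i\<bar> \<le> 3 / d" using d by (simp add: field_simps)
      then show ?thesis unfolding N_def by linarith
    qed
    have "(\<Sum>i'\<in>I. \<Sum>j'\<in>J i'. w i' j' * measure lebesgue (?T i j \<inter> ?T i' j'))
        \<le> (\<Sum>i'\<in>I. \<Lambda> * C powr s * d powr (1 + s) * \<kappa> i i' powr (s - 1))"
      by (intro sum_mono row i)
    also have "\<dots> = \<Lambda> * C powr s * d powr (1 + s) * (\<Sum>i'\<in>I. \<kappa> i i' powr (s - 1))"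
      by (rule sum_distrib_left[symmetric])
    also have "\<dots> \<le> \<Lambda> * C powr s * d powr (1 + s) * (3 * real N powr s / s)"
      unfolding \<kappa>_def using \<Lambda>
      by (intro mult_left_mono powr_sum_int_le[OF s I(1) dist N]) auto
    also have "\<dots> = \<Lambda> * C powr s * 3 / s * d * (real N * d) powr s"
      using d N by (simp add: powr_mult powr_add)
    also have "\<dots> \<le> \<Lambda> * C powr s * 3 / s * d * 3"
    proof (intro mult_left_mono)
      have "(real N * d) powr s \<le> 3 powr s" using Nd d s by (intro powr_mono2) auto
      also have "\<dots> \<le> 3 powr 1" using s by (intro powr_mono) auto
      finally show "(real N * d) powr s \<le> 3" by simp
    qed (use \<Lambda> d s in auto)
    finally show ?thesis by (simp add: H_def)
  qed
  define V where "V = (\<Sum>i\<in>I. \<Sum>j\<in>J i. w i j)"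
  have V0: "0 \<le> V" unfolding V_def by (intro sum_nonneg J)
  have Sig: "(\<Sum>x\<in>Sigma I J. case_prod f x) = (\<Sum>i\<in>I. \<Sum>j\<in>J i. f i j)" for f :: "int \<Rightarrow> int \<Rightarrow> real"
    by (rule sum.Sigma[symmetric]) (use I J in auto)
  let ?w = "case_prod w" and ?S = "case_prod ?T"
  have "(\<Sum>x\<in>Sigma I J. ?w x * measure lebesgue (?S x))\<^sup>2
      \<le> measure lebesgue U * (\<Sum>x\<in>Sigma I J. \<Sum>x'\<in>Sigma I J. ?w x * ?w x' * measure lebesgue (?S x \<inter> ?S x'))"
  proof (rule cauchy_schwarz_overlap)
    show "?S x \<subseteq> U" if "x \<in> Sigma I J" for x
      using that U(2) by (cases x) (simp only: mem_Sigma_iff prod.case)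
  qed (use I(1) J U(1) in \<open>auto simp: strip_lmeasurable\<close>)
  also have "(\<Sum>x\<in>Sigma I J. ?w x * measure lebesgue (?S x)) = V * (2 * d * (q - p))"
    unfolding V_def sum_distrib_right Sig[symmetric] using d pq
    by (auto intro!: sum.cong simp: measure_strip)
  also have "(\<Sum>x\<in>Sigma I J. \<Sum>x'\<in>Sigma I J. ?w x * ?w x' * measure lebesgue (?S x \<inter> ?S x')) \<le> V * (H * d)"
  proof -
    have "(\<Sum>x'\<in>Sigma I J. ?w x * ?w x' * measure lebesgue (?S x \<inter> ?S x')) \<le> ?w x * (H * d)"
      if xS: "x \<in> Sigma I J" for x
    proof -
      obtain i j where x: "x = (i, j)" "i \<in> I" "j \<in> J i" using xS by (cases x) auto
      have "(\<Sum>x'\<in>Sigma I J. ?w x * ?w x' * measure lebesgue (?S x \<inter> ?S x'))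
          = w i j * (\<Sum>x'\<in>Sigma I J. case x' of (i', j') \<Rightarrow> w i' j' * measure lebesgue (?T i j \<inter> ?T i' j'))"
        unfolding sum_distrib_left x by (intro sum.cong) auto
      also have "\<dots> \<le> w i j * (H * d)"
        unfolding Sig by (intro mult_left_mono column J x)
      finally show ?thesis by (simp add: x)
    qed
    then have "(\<Sum>x\<in>Sigma I J. \<Sum>x'\<in>Sigma I J. ?w x * ?w x' * measure lebesgue (?S x \<inter> ?S x'))
        \<le> (\<Sum>x\<in>Sigma I J. ?w x * (H * d))" by (rule sum_mono)
    also have "\<dots> = V * (H * d)"
      unfolding V_def Sig[symmetric] by (rule sum_distrib_right[symmetric])
    finally show ?thesis .
  qed
  finally have "(V * (2 * d * (q - p)))\<^sup>2 \<le> measure lebesgue U * (V * (H * d))"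
    by (simp add: mult_left_mono)
  then have main: "(V * d) * (4 * (q - p)\<^sup>2 * (d * V)) \<le> (V * d) * (measure lebesgue U * H)"
    by (simp add: power2_eq_square algebra_simps)
  have "4 * (q - p)\<^sup>2 * (d * V) \<le> measure lebesgue U * H"
  proof (cases "V = 0")
    case True
    have "0 \<le> H" using \<Lambda> s by (simp add: H_def)
    then show ?thesis using True by simp
  next
    case False
    then have "0 < V * d" using V0 d by simp
    with main show ?thesis by (simp only: mult_le_cancel_left_pos)
  qed
  then show ?thesis by (simp add: V_def H_def \<Lambda>_def C_def)
qed

section \<open>Null sets and uniform families of segments\<close>

definition segment_intercepts :: "(real^2) set \<Rightarrow> real \<Rightarrow> real \<Rightarrow> real \<Rightarrow> real set" where
  "segment_intercepts K p q m = {c. \<forall>x\<in>{p..q}. vector [x, m * x + c] \<in> K}"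

lemma segment_intercepts_bounds:
  assumes K: "K \<subseteq> cball 0 R" and p: "p \<le> q" and c: "c \<in> segment_intercepts K p q m"
  shows "\<bar>p\<bar> \<le> R" "\<bar>q\<bar> \<le> R" "\<bar>m\<bar> \<le> 1 \<Longrightarrow> \<bar>c\<bar> \<le> 2 * R"
proof -
  have ends: "vector [p, m * p + c] \<in> K" "vector [q, m * q + c] \<in> K"
    using p c by (simp_all add: segment_intercepts_def)
  have comp: "\<bar>z $ i\<bar> \<le> R" if "z \<in> K" for z i
    using K that component_le_norm_cart[of z i] by (meson mem_cball_0 order_trans subsetD)
  have le: "\<bar>p\<bar> \<le> R" "\<bar>m * p + c\<bar> \<le> R" "\<bar>q\<bar> \<le> R"
    using comp[OF ends(1), of 1] comp[OF ends(1), of 2] comp[OF ends(2), of 1] by simp_all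
  then show "\<bar>p\<bar> \<le> R" "\<bar>q\<bar> \<le> R" by simp_all
  assume "\<bar>m\<bar> \<le> 1"
  then have "\<bar>m * p\<bar> \<le> 1 * R" unfolding abs_mult using le by (intro mult_mono) auto
  then show "\<bar>c\<bar> \<le> 2 * R" using le by linarith
qed

lemma ennreal_real_below:
  assumes "0 < (x::ennreal)"
  obtains b :: real where "0 < b" "ennreal b < x"
proof -
  obtain y where y: "0 < y" "y < x" using dense[OF assms] by auto
  then obtain r where "0 \<le> r" "y = ennreal r" by (cases y) auto
  with y show thesis using that[of r] by simp
qed

lemma strip_subset_neighbourhood:
  assumes "c \<in> segment_intercepts K p q m" "d < \<eta>" "0 \<le> d"
  shows "strip p q d m c \<subseteq> (\<Union>x\<in>K. ball x \<eta>)"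
proof
  fix z assume z: "z \<in> strip p q d m c"
  let ?z = "vector [z$1, m * z$1 + c] :: real^2"
  have "?z \<in> K" using assms(1) z by (auto simp: segment_intercepts_def strip_def)
  moreover have "dist ?z z < \<eta>"
  proof -
    have "dist ?z z \<le> (\<Sum>i\<in>UNIV. \<bar>(?z - z) $ i\<bar>)" unfolding dist_norm by (rule norm_le_l1_cart)
    also have "\<dots> = \<bar>z$2 - m * z$1 - c\<bar>" by (simp add: sum_2)
    also have "\<dots> < \<eta>" using z assms by (simp add: strip_def)
    finally show ?thesis .
  qed
  ultimately show "z \<in> (\<Union>x\<in>K. ball x \<eta>)" by auto
qed

text \<open>If \<open>K\<close> were null, it would have an open neighbourhood \<open>U\<close> of measure below any given bound. By compactness
\<open>U\<close> contains all strips of some small width \<open>d\<close> around segments of \<open>K\<close>, in contradiction to the lower bound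
for \<open>measure lebesgue U\<close> that holds at every scale \<open>d\<close>. The scale \<open>4 * R\<close> in the hypothesis is the diameter of the
interval that contains all intercepts.\<close>

proposition emeasure_pos_if_uniform_segments:
  assumes K: "compact K" "K \<subseteq> cball 0 R" and R: "0 \<le> R" and pq: "p < q" and s: "0 < s" "s \<le> 1"
    and M: "M \<subseteq> {-1..1}" "0 < hausdorff_measure 1 M"
    and c0: "0 < c\<^sub>0" "\<And>m. m \<in> M \<Longrightarrow> ennreal c\<^sub>0 < hausdorff_premeasure s (4 * R) (segment_intercepts K p q m)"
  shows "0 < emeasure lebesgue K"
proof (rule ccontr)
  assume "\<not> ?thesis"
  then have null: "emeasure lebesgue K = 0" by simp
  let ?A = "segment_intercepts K p q"
  have "0 < hausdorff_premeasure 1 1 M" using M(2) by (intro hausdorff_premeasure_pos) auto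
  then obtain b where b: "0 < b" "ennreal b < hausdorff_premeasure 1 1 M"
    by (rule ennreal_real_below)
  have "M \<noteq> {}" using b(2) by (auto simp: hausdorff_premeasure_empty)
  then obtain m\<^sub>0 where m0: "m\<^sub>0 \<in> M" by auto
  have ne: "?A m \<noteq> {}" if "m \<in> M" for m
    using c0(2)[OF that] R by (auto simp: hausdorff_premeasure_empty)
  have bnd: "\<bar>p\<bar> \<le> R" "\<bar>q\<bar> \<le> R"
    using ne[OF m0] segment_intercepts_bounds(1,2)[OF K(2) less_imp_le[OF pq]] by blast+
  define H where "H = 9 * (8 + 2 * (q - p)) * (4 * R + 6) powr s / s"
  have H: "0 < H" using pq s R by (simp add: H_def)
  \<comment> \<open>The lower bound for \<open>measure lebesgue U\<close> that the strips will give.\<close>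
  define \<epsilon> where "\<epsilon> = 4 * (q - p)\<^sup>2 * (b * c\<^sub>0) / H"
  have \<epsilon>: "0 < \<epsilon>" using pq b c0 H by (simp add: \<epsilon>_def)
  have KL: "K \<in> lmeasurable" by (rule lmeasurable_compact[OF K(1)])
  obtain U where U: "open U" "K \<subseteq> U" "U - K \<in> lmeasurable" "emeasure lebesgue (U - K) < ennreal \<epsilon>"
    using sets_lebesgue_outer_open[OF fmeasurableD[OF KL] \<epsilon>] .
  have UL: "U \<in> lmeasurable"
    using fmeasurable.Un[OF KL U(3)] U(2) by (simp add: Un_absorb1)
  have "emeasure lebesgue U \<le> emeasure lebesgue K + emeasure lebesgue (U - K)"
    using emeasure_subadditive[of K lebesgue "U - K"] KL U(2,3) by (simp add: Un_absorb1 fmeasurableD)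
  then have "emeasure lebesgue U < ennreal \<epsilon>" using U(4) null by simp
  then have small: "measure lebesgue U < \<epsilon>"
    using \<epsilon> emeasure_eq_measure2[OF UL] by (simp add: ennreal_less_iff)
  obtain \<eta> where \<eta>: "0 < \<eta>" "(\<Union>x\<in>K. ball x \<eta>) \<subseteq> U"
    using compact_subset_open_imp_ball_epsilon_subset[OF K(1) U(1,2)] .
  define d where "d = min 1 (\<eta> / 2)"
  have d: "0 < d" "d \<le> 1" "d < \<eta>" using \<eta> by (auto simp: d_def)
  obtain I m where I: "finite I" "\<And>i. i \<in> I \<Longrightarrow> m i \<in> M" "b \<le> real (card I) * d"
    "\<And>i. i \<in> I \<Longrightarrow> of_int i * d < m i" "\<And>i. i \<in> I \<Longrightarrow> m i \<le> of_int (i + 1) * d"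
    using separated_slopes[OF M(1) d(1,2) b(2)] by blast
  have R4: "2 * (2 * R) \<le> 4 * R" "0 \<le> 2 * R" using R by simp_all
  have "\<forall>i\<in>I. \<exists>(J :: int set) y w. finite J \<and> (\<forall>j\<in>J. y j \<in> ?A (m i)) \<and> (\<forall>j\<in>J. 0 \<le> w j) \<and>
      c\<^sub>0 \<le> sum w J \<and> (\<forall>x r. 0 \<le> r \<longrightarrow> (\<Sum>j\<in>{j\<in>J. \<bar>y j - x\<bar> \<le> r}. w j) \<le> (2 * r + 2 * d) powr s)"
    (is "\<forall>i\<in>I. ?weights i")
  proof
    fix i assume i: "i \<in> I"
    have "?A (m i) \<subseteq> {-(2 * R)..2 * R}"
    proof
      fix c assume "c \<in> ?A (m i)"
      moreover have "\<bar>m i\<bar> \<le> 1" using I(2)[OF i] M(1) by (force simp: abs_le_iff)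
      ultimately have "\<bar>c\<bar> \<le> 2 * R"
        by (rule segment_intercepts_bounds(3)[OF K(2) less_imp_le[OF pq]])
      then show "c \<in> {-(2 * R)..2 * R}" by auto
    qed
    from discrete_frostman[OF s(1) this R4 d(1) c0(2)[OF I(2)[OF i]]] show "?weights i" .
  qed
  then obtain J :: "int \<Rightarrow> int set" and y w where JJ: "\<forall>i\<in>I. finite (J i) \<and> (\<forall>j\<in>J i. y i j \<in> ?A (m i)) \<and>
      (\<forall>j\<in>J i. 0 \<le> w i j) \<and> c\<^sub>0 \<le> sum (w i) (J i) \<and>
      (\<forall>x r. 0 \<le> r \<longrightarrow> (\<Sum>j\<in>{j\<in>J i. \<bar>y i j - x\<bar> \<le> r}. w i j) \<le> (2 * r + 2 * d) powr s)"
    unfolding bchoice_iff by (elim exE) (rule that)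
  have J: "\<And>i. i \<in> I \<Longrightarrow> finite (J i)"
      "\<And>i j. i \<in> I \<Longrightarrow> j \<in> J i \<Longrightarrow> y i j \<in> ?A (m i)"
      "\<And>i j. i \<in> I \<Longrightarrow> j \<in> J i \<Longrightarrow> 0 \<le> w i j" "\<And>i. i \<in> I \<Longrightarrow> c\<^sub>0 \<le> sum (w i) (J i)"
      "\<And>i x r. i \<in> I \<Longrightarrow> 0 \<le> r \<Longrightarrow> (\<Sum>j\<in>{j\<in>J i. \<bar>y i j - x\<bar> \<le> r}. w i j) \<le> (2 * r + 2 * d) powr s"
    using JJ by simp_all
  have low: "4 * (q - p)\<^sup>2 * (d * (\<Sum>i\<in>I. \<Sum>j\<in>J i. w i j)) \<le> measure lebesgue U * H"
    unfolding H_def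
  proof (rule strip_family_measure_lower_bound[OF pq bnd s d(1,2) I(1) _ I(4,5) J(1,3,5) UL])
    show "m i \<in> {-1..1}" if "i \<in> I" for i using I(2)[OF that] M(1) by blast
    show "strip p q d (m i) (y i j) \<subseteq> U" if "i \<in> I" "j \<in> J i" for i j
      using strip_subset_neighbourhood[OF J(2)[OF that] d(3)] d(1) \<eta>(2) by (meson less_imp_le order_trans)
  qed
  have "b * c\<^sub>0 \<le> d * (\<Sum>i\<in>I. \<Sum>j\<in>J i. w i j)"
  proof -
    have "real (card I) * c\<^sub>0 \<le> (\<Sum>i\<in>I. \<Sum>j\<in>J i. w i j)"
      using sum_mono[of I "\<lambda>_. c\<^sub>0"] J(4) by simp
    then have "d * (real (card I) * c\<^sub>0) \<le> d * (\<Sum>i\<in>I. \<Sum>j\<in>J i. w i j)"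
      using d by (intro mult_left_mono) auto
    moreover have "b * c\<^sub>0 \<le> real (card I) * d * c\<^sub>0"
      using I(3) c0(1) by (intro mult_right_mono) auto
    ultimately show ?thesis by (simp add: mult_ac)
  qed
  then have "4 * (q - p)\<^sup>2 * (b * c\<^sub>0) \<le> 4 * (q - p)\<^sup>2 * (d * (\<Sum>i\<in>I. \<Sum>j\<in>J i. w i j))"
    by (intro mult_left_mono) auto
  with low have "4 * (q - p)\<^sup>2 * (b * c\<^sub>0) \<le> measure lebesgue U * H"
    by linarith
  then have "\<epsilon> \<le> measure lebesgue U" using H by (simp add: \<epsilon>_def field_simps)
  with small show False by simp
qed

section \<open>Reduction to uniform families\<close>

definition slope_perp :: "real^2 \<Rightarrow> real" where
  "slope_perp e = - e$1 / e$2"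

text \<open>With \<open>k\<close> the cross product and \<open>t\<close> the inner product of the two unit vectors, \<open>k\<^sup>2 = (1 - t) * (1 + t)\<close> and
the squared distance is \<open>2 * (1 - t)\<close>. The hypotheses on the components force \<open>t \<ge> 0\<close>, which excludes
nearly antipodal vectors, and \<open>\<bar>k\<bar>\<close> is at most the difference of the slopes.\<close>

lemma slope_perp_expanding:
  assumes "e \<in> sphere 0 1" "e' \<in> sphere 0 1" "\<bar>e$1\<bar> \<le> \<bar>e$2\<bar>" "\<bar>e'$1\<bar> \<le> \<bar>e'$2\<bar>" "0 < e$2 * e'$2"
  shows "dist e e' \<le> 2 * dist (slope_perp e) (slope_perp e')"
proof -
  have e: "(e$1)\<^sup>2 + (e$2)\<^sup>2 = 1" "(e'$1)\<^sup>2 + (e'$2)\<^sup>2 = 1"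
    using assms(1,2) by (simp_all add: norm_vec_def L2_set_def sum_2)
  define k where "k = e'$1 * e$2 - e$1 * e'$2"
  define t where "t = e$1 * e'$1 + e$2 * e'$2"
  have id: "k\<^sup>2 = (1 - t) * (1 + t)"
  proof -
    have "k\<^sup>2 + t\<^sup>2 = ((e$1)\<^sup>2 + (e$2)\<^sup>2) * ((e'$1)\<^sup>2 + (e'$2)\<^sup>2)"
      unfolding k_def t_def by (simp add: power2_eq_square algebra_simps)
    then have "k\<^sup>2 + t\<^sup>2 = 1" unfolding e by simp
    then show ?thesis by (simp add: power2_eq_square algebra_simps)
  qed
  have t0: "0 \<le> t"
  proof -
    have "\<bar>e$1 * e'$1\<bar> \<le> \<bar>e$2 * e'$2\<bar>" unfolding abs_mult using assms by (intro mult_mono) auto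
    then show ?thesis unfolding t_def using assms(5) by linarith
  qed
  have d2: "(dist e e')\<^sup>2 = 2 * (1 - t)"
  proof -
    have "(dist e e')\<^sup>2 = (e$1 - e'$1)\<^sup>2 + (e$2 - e'$2)\<^sup>2"
      by (simp add: dist_norm norm_vec_def L2_set_def sum_2)
    also have "\<dots> = ((e$1)\<^sup>2 + (e$2)\<^sup>2) + ((e'$1)\<^sup>2 + (e'$2)\<^sup>2) - 2 * t"
      unfolding t_def by (simp add: power2_eq_square algebra_simps)
    finally show ?thesis using e by simp
  qed
  have "0 \<le> 1 - t" using d2 by (metis zero_le_mult_iff zero_le_power2 not_numeral_le_zero zero_le_numeral)
  then have "1 - t \<le> k\<^sup>2" unfolding id using t0 mult_left_mono[of 1 "1 + t" "1 - t"] by simp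
  then have "(dist e e')\<^sup>2 \<le> (2 * \<bar>k\<bar>)\<^sup>2" unfolding d2 by (simp add: power_mult_distrib) (use \<open>0 \<le> 1 - t\<close> in linarith)
  then have "dist e e' \<le> 2 * \<bar>k\<bar>" by (rule power2_le_imp_le) simp
  also have "\<bar>k\<bar> \<le> dist (slope_perp e) (slope_perp e')"
  proof -
    have nz: "e$2 \<noteq> 0" "e'$2 \<noteq> 0" using assms(5) by auto
    have "\<bar>e$2\<bar> \<le> 1" "\<bar>e'$2\<bar> \<le> 1"
      using component_le_norm_cart[of e 2] component_le_norm_cart[of e' 2] assms(1,2) by auto
    then have le1: "\<bar>e$2 * e'$2\<bar> \<le> 1" unfolding abs_mult by (intro mult_le_one) auto
    have "k = (slope_perp e - slope_perp e') * (e$2 * e'$2)"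
      unfolding k_def slope_perp_def using nz by (simp add: field_simps)
    then have "\<bar>k\<bar> = \<bar>slope_perp e - slope_perp e'\<bar> * \<bar>e$2 * e'$2\<bar>" by (simp add: abs_mult)
    also have "\<dots> \<le> \<bar>slope_perp e - slope_perp e'\<bar>"
      using mult_left_mono[OF le1, of "\<bar>slope_perp e - slope_perp e'\<bar>"] by simp
    finally show ?thesis by (simp add: dist_real_def)
  qed
  finally show ?thesis by simp
qed

text \<open>Rational end points make the family of windows \<open>{p..q}\<close> countable.\<close>

lemma segment_gives_intercept:
  assumes e: "e$2 \<noteq> 0" and S: "line_segment_perp e S" "S \<subseteq> K" and x: "x \<in> S"
  obtains p q c where "p \<in> \<rat>" "q \<in> \<rat>" "p < q" "c \<in> segment_intercepts K p q (slope_perp e)"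
    "proj_dir e x = e$2 * c"
proof -
  obtain a b where ab: "a \<noteq> b" "S = closed_segment a b" "(b - a) \<bullet> e = 0"
    using S(1) unfolding line_segment_perp_def by blast
  define m where "m = slope_perp e"
  define c where "c = a$2 - m * a$1"
  have "(b$1 - a$1) * e$1 + (b$2 - a$2) * e$2 = 0"
    using ab(3) by (simp add: inner_vec_def sum_2)
  then have ba: "b$2 - a$2 = m * (b$1 - a$1)"
    using e unfolding m_def slope_perp_def by (simp add: field_simps)
  have ne: "a$1 \<noteq> b$1"
    using ab(1) ba by (auto simp: vec_eq_iff forall_2)
  then have "min (a$1) (b$1) < max (a$1) (b$1)" by auto
  then obtain p where p: "p \<in> \<rat>" "min (a$1) (b$1) < p" "p < max (a$1) (b$1)"
    using Rats_dense_in_real by blast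
  then obtain q where q: "q \<in> \<rat>" "p < q" "q < max (a$1) (b$1)"
    using Rats_dense_in_real by blast
  have "c \<in> segment_intercepts K p q m"
    unfolding segment_intercepts_def
  proof (intro CollectI ballI)
    fix t assume t: "t \<in> {p..q}"
    define u where "u = (t - a$1) / (b$1 - a$1)"
    have u: "0 \<le> u" "u \<le> 1"
      using t p q ne unfolding u_def by (auto simp: min_def max_def divide_simps split: if_splits)
    have ut: "u * (b$1 - a$1) = t - a$1" using ne by (simp add: u_def)
    have "vector [t, m * t + c] = (1 - u) *\<^sub>R a + u *\<^sub>R b"
    proof -
      have "a$1 + u * (b$1 - a$1) = t" using ut by simp
      moreover have "a$2 + u * (b$2 - a$2) = m * t + c"
        unfolding ba c_def using arg_cong[OF ut, of "\<lambda>v. m * v"] by (simp add: algebra_simps)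
      ultimately show ?thesis by (simp add: vec_eq_iff forall_2 algebra_simps)
    qed
    then have "vector [t, m * t + c] \<in> S" using u ab(2) unfolding closed_segment_def by blast
    then show "vector [t, m * t + c] \<in> K" using S(2) by blast
  qed
  moreover have "proj_dir e x = e$2 * c"
  proof -
    obtain u where "x = a + u *\<^sub>R (b - a)"
      using x ab(2) unfolding closed_segment_def by (auto simp: algebra_simps)
    then have "x \<bullet> e = a \<bullet> e" using ab(3) by (simp add: inner_add_left)
    then show ?thesis using e
      by (simp add: proj_dir_def c_def m_def slope_perp_def inner_vec_def sum_2 field_simps)
  qed
  ultimately show thesis using that p q by (simp add: m_def)
qed

text \<open>The projections of the segments are, up to the factor \<open>e$2\<close>, the intercepts of their lines. They are covered by
countably many sets, one for each rational window, so that one window carries positive measure.\<close>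

lemma exists_rational_window:
  assumes e: "e \<in> sphere 0 1" "e$2 \<noteq> 0"
    and F: "positive_dimensional_family e F" "\<Union>F \<subseteq> K"
  obtains p q s where "p \<in> \<rat>" "q \<in> \<rat>" "p < q" "0 < s" "s \<le> 1"
    "0 < hausdorff_measure s (segment_intercepts K p q (slope_perp e))"
proof -
  obtain s where s: "0 < s" "s \<le> 1" and F': "\<And>S. S \<in> F \<Longrightarrow> line_segment_perp e S"
    and pos: "0 < hausdorff_measure s (proj_dir e ` (\<Union>F))"
    using F(1) unfolding positive_dimensional_family_def dimensional_family_def by auto
  define W where "W = {(p, q). p \<in> \<rat> \<and> q \<in> \<rat> \<and> p < (q::real)}"
  let ?A = "\<lambda>(p, q). segment_intercepts K p q (slope_perp e)"
  have "countable W"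
    by (rule countable_subset[of _ "\<rat> \<times> \<rat>"]) (auto simp: W_def countable_rat)
  have "proj_dir e ` (\<Union>F) \<subseteq> (\<Union>w\<in>W. (\<lambda>c. e$2 * c) ` ?A w)"
  proof
    fix t assume "t \<in> proj_dir e ` (\<Union>F)"
    then obtain S x where x: "S \<in> F" "x \<in> S" "t = proj_dir e x" by auto
    have "S \<subseteq> K" using x F(2) by auto
    from segment_gives_intercept[OF e(2) F'[OF x(1)] this x(2)]
    obtain p q c where pqc: "p \<in> \<rat>" "q \<in> \<rat>" "p < q" "c \<in> segment_intercepts K p q (slope_perp e)"
      "proj_dir e x = e$2 * c" .
    then have "(p, q) \<in> W" "c \<in> ?A (p, q)" by (simp_all add: W_def)
    then show "t \<in> (\<Union>w\<in>W. (\<lambda>c. e$2 * c) ` ?A w)" using x(3) pqc(5) by blast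
  qed
  then have "0 < hausdorff_measure s (\<Union>w\<in>W. (\<lambda>c. e$2 * c) ` ?A w)"
    by (rule order_less_le_trans[OF pos hausdorff_measure_mono])
  from hausdorff_measure_UN_pos[OF this \<open>countable W\<close>]
  obtain w where w: "w \<in> W" "0 < hausdorff_measure s ((\<lambda>c. e$2 * c) ` ?A w)" .
  have "1-lipschitz_on (?A w) (\<lambda>c. e$2 * c)"
  proof (rule lipschitz_onI)
    fix x y
    have "\<bar>e$2\<bar> \<le> 1" using component_le_norm_cart[of e 2] e(1) by simp
    then show "dist (e$2 * x) (e$2 * y) \<le> 1 * dist x y"
      by (simp add: dist_real_def right_diff_distrib[symmetric] abs_mult mult_left_le_one_le)
  qed simp
  then have "0 < hausdorff_measure s (?A w)"
    using hausdorff_measure_lipschitz_pos[OF w(2)] s by simp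
  then show thesis using that w(1) s by (auto simp: W_def)
qed

text \<open>Four parameters depend on the direction: the window \<open>{p..q}\<close>, the exponent and a lower bound for the
content of the intercepts. Positive content for one exponent implies positive content for all smaller
ones, so the last two may be taken of the form \<open>1 / (n + 1)\<close> and \<open>1 / (k + 1)\<close>; then one quadruple serves a set of slopes
of positive measure. The sign \<open>\<sigma>\<close> keeps to one half of the circle, on which the slope determines the
direction in a Lipschitz way.\<close>

proposition emeasure_pos_if_shallow_directions:
  assumes K: "compact K" and E: "E \<subseteq> sphere 0 1" "0 < hausdorff_measure 1 E"
    and shallow: "\<And>e. e \<in> E \<Longrightarrow> \<bar>e$1\<bar> \<le> \<bar>e$2\<bar>"
    and F: "\<And>e. e \<in> E \<Longrightarrow> \<exists>F. positive_dimensional_family e F \<and> \<Union>F \<subseteq> K"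
  shows "0 < emeasure lebesgue (K :: (real^2) set)"
proof -
  obtain R where "0 < R" "K \<subseteq> ball 0 R"
    using bounded_subset_ballD[OF compact_imp_bounded[OF K]] by blast
  then have R: "0 \<le> R" "K \<subseteq> cball 0 R" using ball_subset_cball by auto
  have nz: "e$2 \<noteq> 0" if "e \<in> E" for e
  proof
    assume "e$2 = 0"
    then have "e = 0" using shallow[OF that] by (simp add: vec_eq_iff forall_2)
    then show False using E(1) that by auto
  qed
  let ?E = "\<lambda>\<sigma>::real. {e\<in>E. 0 < \<sigma> * e$2}"
  have "E = (\<Union>\<sigma>\<in>{1, -1}. ?E \<sigma>)" using nz by fastforce
  then obtain \<sigma> where \<sigma>: "0 < hausdorff_measure 1 (?E \<sigma>)"
    using hausdorff_measure_UN_pos[of 1 ?E "{1, -1}"] E(2) by auto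
  have slopes: "0 < hausdorff_measure 1 (slope_perp ` ?E \<sigma>)"
  proof (rule hausdorff_measure_expanding_pos[OF \<sigma>, of 2])
    fix e e' assume "e \<in> ?E \<sigma>" "e' \<in> ?E \<sigma>"
    moreover from this have "0 < (\<sigma> * e$2) * (\<sigma> * e'$2)" by simp
    then have "0 < \<sigma>\<^sup>2 * (e$2 * e'$2)" by (simp add: power2_eq_square mult_ac)
    then have "0 < e$2 * e'$2" by (simp add: zero_less_mult_iff)
    ultimately show "dist e e' \<le> 2 * dist (slope_perp e) (slope_perp e')"
      using E(1) shallow by (intro slope_perp_expanding) auto
  qed auto
  define X where "X = {(p, q :: real, n :: nat, k :: nat). p \<in> \<rat> \<and> q \<in> \<rat> \<and> p < q}"
  have "countable X"
    by (rule countable_subset[of _ "\<rat> \<times> \<rat> \<times> UNIV \<times> UNIV"]) (auto simp: X_def countable_rat)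
  let ?M = "\<lambda>(p, q, n, k). {m\<in>{-1..1}. ennreal (inverse (real (Suc k)))
    < hausdorff_premeasure (inverse (real (Suc n))) (4 * R) (segment_intercepts K p q m)}"
  have "slope_perp ` ?E \<sigma> \<subseteq> (\<Union>x\<in>X. ?M x)"
  proof
    fix m assume "m \<in> slope_perp ` ?E \<sigma>"
    then obtain e where e: "e \<in> E" "m = slope_perp e" by auto
    have "\<bar>m\<bar> \<le> 1" using shallow[OF e(1)] nz[OF e(1)] by (simp add: e(2) slope_perp_def divide_le_eq_1)
    then have m: "m \<in> {-1..1}" by auto
    obtain F where "positive_dimensional_family e F" "\<Union>F \<subseteq> K" using F[OF e(1)] by auto
    then obtain p q s where pq: "p \<in> \<rat>" "q \<in> \<rat>" "p < q" and s: "0 < s" "s \<le> 1"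
      "0 < hausdorff_measure s (segment_intercepts K p q m)"
      using exists_rational_window[OF _ nz[OF e(1)]] E(1) e by (metis subsetD)
    obtain n where n: "inverse (real (Suc n)) < s" using reals_Archimedean[OF s(1)] by auto
    have "0 < hausdorff_premeasure (inverse (real (Suc n))) (4 * R) (segment_intercepts K p q m)"
      using s(3) n by (intro hausdorff_premeasure_pos) auto
    then obtain b where b: "0 < b"
      "ennreal b < hausdorff_premeasure (inverse (real (Suc n))) (4 * R) (segment_intercepts K p q m)"
      by (rule ennreal_real_below)
    obtain k where "inverse (real (Suc k)) < b" using reals_Archimedean[OF b(1)] by auto
    then have "ennreal (inverse (real (Suc k))) \<le> ennreal b" by (intro ennreal_leI) simp
    then have "m \<in> ?M (p, q, n, k)" using m b(2) by simp
    moreover have "(p, q, n, k) \<in> X" using pq by (simp add: X_def)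
    ultimately show "m \<in> (\<Union>x\<in>X. ?M x)" by blast
  qed
  then have "0 < hausdorff_measure 1 (\<Union>x\<in>X. ?M x)"
    by (rule order_less_le_trans[OF slopes hausdorff_measure_mono])
  from hausdorff_measure_UN_pos[OF this \<open>countable X\<close>]
  obtain x where x: "x \<in> X" "0 < hausdorff_measure 1 (?M x)" .
  obtain p q n k where pqnk: "x = (p, q, n, k)" by (cases x)
  show ?thesis
  proof (rule emeasure_pos_if_uniform_segments[OF K R(2,1)])
    show "p < q" using x(1) by (simp add: X_def pqnk)
    show "inverse (real (Suc n)) \<le> 1" by (simp add: inverse_le_1_iff)
    show "0 < hausdorff_measure 1 (?M x)" by (fact x(2))
    show "0 < inverse (real (Suc k))" by simp
  qed (use R in \<open>auto simp: pqnk\<close>)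
qed

text \<open>For the exchange of the two coordinates, which turns steep directions into shallow ones.\<close>

lemma positive_dimensional_family_orthogonal_image:
  assumes f: "orthogonal_transformation f" and F: "positive_dimensional_family e F"
  shows "positive_dimensional_family (f e) ((`) f ` F)"
proof -
  have lin: "linear f" and inner: "\<And>x y. f x \<bullet> f y = x \<bullet> y"
    using f by (auto simp: orthogonal_transformation_def)
  have "line_segment_perp (f e) (f ` S)" if "line_segment_perp e S" for S
  proof -
    obtain a b where ab: "a \<noteq> b" "S = closed_segment a b" "(b - a) \<bullet> e = 0"
      using \<open>line_segment_perp e S\<close> unfolding line_segment_perp_def by blast
    have "f a \<noteq> f b" using orthogonal_transformation_inj[OF f] ab(1) by (simp add: inj_eq)
    moreover have "f ` S = closed_segment (f a) (f b)"
      by (simp add: ab(2) closed_segment_linear_image[OF lin])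
    moreover have "(f b - f a) \<bullet> f e = 0"
      by (simp add: linear_diff[OF lin, symmetric] inner ab(3))
    ultimately show ?thesis unfolding line_segment_perp_def by blast
  qed
  moreover have "proj_dir (f e) ` (\<Union>((`) f ` F)) = proj_dir e ` (\<Union>F)"
    by (simp add: image_Union[symmetric] image_image proj_dir_def inner)
  ultimately show ?thesis
    using F unfolding positive_dimensional_family_def dimensional_family_def by auto
qed

theorem theorem1p1:
  fixes K :: "(real^2) set" and E\<^sub>0 :: "(real^2) set"
  assumes "compact K"
    and "E\<^sub>0 \<subseteq> sphere 0 1"
    and "hausdorff_measure 1 E\<^sub>0 > 0"
    and "\<And>e. e \<in> E\<^sub>0 \<Longrightarrow> \<exists>F. positive_dimensional_family e F \<and> \<Union>F \<subseteq> K"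
  shows "emeasure lebesgue K > 0"
proof -
  let ?E = "\<lambda>b. {e\<in>E\<^sub>0. if b then \<bar>e$1\<bar> \<le> \<bar>e$2\<bar> else \<bar>e$2\<bar> \<le> \<bar>e$1\<bar>}"
  have "E\<^sub>0 = (\<Union>b. ?E b)" by (force simp: UNIV_bool)
  then obtain b where b: "0 < hausdorff_measure 1 (?E b)"
    using hausdorff_measure_UN_pos[of 1 ?E UNIV] assms(3) by auto
  show ?thesis
  proof (cases b)
    case True
    show ?thesis
      by (rule emeasure_pos_if_shallow_directions[OF assms(1) _ b]) (use assms(2,4) True in auto)
  next
    case False
    define f where "f = (\<lambda>z::real^2. vector [z$2, z$1] :: real^2)"
    have f: "orthogonal_transformation f"
      unfolding orthogonal_transformation_def f_def
      by (auto intro!: linearI simp: vec_eq_iff forall_2 inner_vec_def sum_2)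
    have iso: "dist (f x) (f y) = dist x y" for x y
      using f by (simp add: dist_norm orthogonal_transformation_linear linear_diff[symmetric] orthogonal_transformation_norm)
    have "0 < emeasure lebesgue (f ` K)"
    proof (rule emeasure_pos_if_shallow_directions)
      show "compact (f ` K)"
        using assms(1) orthogonal_transformation_linear[OF f]
        by (intro compact_continuous_image linear_continuous_on) (simp_all add: linear_linear)
      show "0 < hausdorff_measure 1 (f ` ?E b)"
        by (rule hausdorff_measure_expanding_pos[OF b, of 1]) (auto simp: iso)
      show "f ` ?E b \<subseteq> sphere 0 1"
        using assms(2) f by (auto simp: orthogonal_transformation_norm)
      show "\<bar>e$1\<bar> \<le> \<bar>e$2\<bar>" if "e \<in> f ` ?E b" for e using that False by (auto simp: f_def)
      show "\<exists>F. positive_dimensional_family e F \<and> \<Union>F \<subseteq> f ` K" if fe: "e \<in> f ` ?E b" for e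
      proof -
        obtain e' where e': "e' \<in> E\<^sub>0" "e = f e'" using fe by auto
        then obtain F where "positive_dimensional_family e' F" "\<Union>F \<subseteq> K" using assms(4) by blast
        then have "positive_dimensional_family e ((`) f ` F)" "\<Union>((`) f ` F) \<subseteq> f ` K"
          using positive_dimensional_family_orthogonal_image[OF f] e' by auto
        then show ?thesis by blast
      qed
    qed
    moreover have "emeasure lebesgue (f ` K) = emeasure lebesgue K"
      using lmeasurable_compact[OF assms(1)] measurable_orthogonal_image[OF f] measure_orthogonal_image[OF f]
      by (simp add: emeasure_eq_measure2)
    ultimately show ?thesis by simp
  qed
qed

end
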